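(* Let $\rho$ be a state of two qubits. The maximum of the fidelity $F(\Lambda(\rho))$ over all trace-preserving PPT-operations $\Lambda$ from two qubits to two qubits is attained by a trace-preserving LOCC operation; that is, $$\max_{\Lambda\ \mathrm{PPT}}F(\Lambda(\rho))=\max_{\Lambda\ \mathrm{LOCC}}F(\Lambda(\rho)).$$
   Context: A state of two qubits is a positive semidefinite operator of trace one on $\mathbb{C}^2\otimes\mathbb{C}^2$. The fidelity (maximal singlet fraction) is $F(\rho)=\max_{|\psi\rangle}\langle\psi|\rho|\psi\rangle$, the maximum being over all maximally entangled unit vectors, i.e. $|\psi\rangle=(U\otimes V)(|00\rangle+|11\rangle)/\sqrt2$ with $U,V$ unitary. A trace-preserving LOCC operation is a completely positive trace-preserving map realized by finitely many rounds of local quantum operations (local instruments) by the two parties, each of which may depend on classical communication of earlier outcomes. A trace-preserving completely positive map $\Lambda$ from operators on $A\otimes B$ to operators on $A'\otimes B'$ (all four systems being qubits) has a dual state $\rho_\Lambda\geq0$ on $A\otimes A'\otimes B\otimes B'$, determined by $$\big(\Lambda(\rho)\big)^T_{A'B'}=4\,\mathrm{Tr}_{AB}\big(\rho_\Lambda(\rho_{AB}\otimes I_{A'B'})\big)\quad\text{for all }\rho,$$ with trace preservation expressed by $4\,\mathrm{Tr}_{A'B'}(\rho_\Lambda)=I_{AB}$. The map $\Lambda$ is called a PPT-operation if $\rho_\Lambda^{T_{BB'}}\ge0$, where $T_{BB'}$ denotes the partial transpose with respect to the systems $B$ and $B'$. *)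

theory Defs
  imports "Jordan_Normal_Form.Schur_Decomposition"
begin

(* Operators on C^n are n x n complex matrices.  The product basis vector e_i (x) e_j of
   C^m (x) C^n has index i * n + j, so a two-qubit operator is a 4 x 4 matrix. *)

section \<open>States\<close>

definition mat_trace :: "complex mat \<Rightarrow> complex" where
  "mat_trace A = (\<Sum>i<dim_row A. A $$ (i, i))"

(* In the order of complex numbers used here, 0 \<le> z says that z is real and nonnegative;
   in particular a matrix that is positive semidefinite in this sense is Hermitian. *)
definition psd :: "nat \<Rightarrow> complex mat \<Rightarrow> bool" where
  "psd n A \<longleftrightarrow> A \<in> carrier_mat n n \<and> (\<forall>v \<in> carrier_vec n. 0 \<le> (A *\<^sub>v v) \<bullet>c v)"

definition density_op :: "nat \<Rightarrow> complex mat \<Rightarrow> bool" where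
  "density_op n \<rho> \<longleftrightarrow> psd n \<rho> \<and> mat_trace \<rho> = 1"


section \<open>Fidelity\<close>

definition kron :: "complex mat \<Rightarrow> complex mat \<Rightarrow> complex mat" where
  "kron A B = mat (dim_row A * dim_row B) (dim_col A * dim_col B)
     (\<lambda>(i, j). A $$ (i div dim_row B, j div dim_col B) * B $$ (i mod dim_row B, j mod dim_col B))"

definition unitary_mat :: "nat \<Rightarrow> complex mat \<Rightarrow> bool" where
  "unitary_mat n U \<longleftrightarrow> U \<in> carrier_mat n n \<and> mat_adjoint U * U = 1\<^sub>m n"

(* (|00> + |11>) / sqrt 2 *)
definition bell_vec :: "complex vec" where
  "bell_vec = complex_of_real (1 / sqrt 2) \<cdot>\<^sub>v (unit_vec 4 0 + unit_vec 4 3)"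

definition max_entangled :: "complex vec set" where
  "max_entangled = {kron U V *\<^sub>v bell_vec | U V. unitary_mat 2 U \<and> unitary_mat 2 V}"

(* The set of maximally entangled vectors is compact, so the supremum is a maximum. *)
definition fidelity :: "complex mat \<Rightarrow> real" where
  "fidelity \<rho> = (SUP \<psi> \<in> max_entangled. Re ((\<rho> *\<^sub>v \<psi>) \<bullet>c \<psi>))"


section \<open>Completely positive maps\<close>

type_synonym superop = "complex mat \<Rightarrow> complex mat"

definition linear_superop :: "nat \<Rightarrow> nat \<Rightarrow> superop \<Rightarrow> bool" where
  "linear_superop n m \<Lambda> \<longleftrightarrow>
     (\<forall>X \<in> carrier_mat n n. \<Lambda> X \<in> carrier_mat m m) \<and>
     (\<forall>X \<in> carrier_mat n n. \<forall>Y \<in> carrier_mat n n. \<Lambda> (X + Y) = \<Lambda> X + \<Lambda> Y) \<and>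
     (\<forall>c. \<forall>X \<in> carrier_mat n n. \<Lambda> (c \<cdot>\<^sub>m X) = c \<cdot>\<^sub>m \<Lambda> X)"

(* For \<Lambda> from operators on C^n to operators on C^m:
   id (x) \<Lambda> on C^k (x) C^n, and \<Lambda> (x) id on C^n (x) C^k. *)
definition id_tensor :: "nat \<Rightarrow> nat \<Rightarrow> nat \<Rightarrow> superop \<Rightarrow> superop" where
  "id_tensor k n m \<Lambda> X = mat (k * m) (k * m) (\<lambda>(i, j).
     \<Lambda> (mat n n (\<lambda>(r, s). X $$ ((i div m) * n + r, (j div m) * n + s))) $$ (i mod m, j mod m))"

definition tensor_id :: "nat \<Rightarrow> nat \<Rightarrow> nat \<Rightarrow> superop \<Rightarrow> superop" where
  "tensor_id n m k \<Lambda> X = mat (m * k) (m * k) (\<lambda>(i, j).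
     \<Lambda> (mat n n (\<lambda>(r, s). X $$ (r * k + i mod k, s * k + j mod k))) $$ (i div k, j div k))"

definition cp_map :: "nat \<Rightarrow> nat \<Rightarrow> superop \<Rightarrow> bool" where
  "cp_map n m \<Lambda> \<longleftrightarrow> linear_superop n m \<Lambda> \<and>
     (\<forall>k X. psd (k * n) X \<longrightarrow> psd (k * m) (id_tensor k n m \<Lambda> X))"

definition cptp_map :: "nat \<Rightarrow> nat \<Rightarrow> superop \<Rightarrow> bool" where
  "cptp_map n m \<Lambda> \<longleftrightarrow> cp_map n m \<Lambda> \<and> (\<forall>X \<in> carrier_mat n n. mat_trace (\<Lambda> X) = mat_trace X)"


section \<open>PPT-operations\<close>

(* Index of the basis vector |a a' b b'> of A (x) A' (x) B (x) B'. *)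
definition idx4 :: "nat \<Rightarrow> nat \<Rightarrow> nat \<Rightarrow> nat \<Rightarrow> nat" where
  "idx4 a a' b b' = 8 * a + 4 * a' + 2 * b + b'"

(* \<rho>_{AB} (x) I_{A'B'} with the factors in the order A, A', B, B': for i = idx4 a a' b b',
   the indices of i in AB and in A'B' are 2 * a + b and 2 * a' + b'. *)
definition AB_part :: "nat \<Rightarrow> nat" where
  "AB_part i = 2 * (i div 8) + (i div 2) mod 2"

definition A'B'_part :: "nat \<Rightarrow> nat" where
  "A'B'_part i = 2 * ((i div 4) mod 2) + i mod 2"

definition tensor_I_A'B' :: "complex mat \<Rightarrow> complex mat" where
  "tensor_I_A'B' \<rho> = mat 16 16 (\<lambda>(i, j).
     \<rho> $$ (AB_part i, AB_part j) * (if A'B'_part i = A'B'_part j then 1 else 0))"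

definition ptrace_AB :: "complex mat \<Rightarrow> complex mat" where
  "ptrace_AB R = mat 4 4 (\<lambda>(i, j). \<Sum>a<2. \<Sum>b<2.
     R $$ (idx4 a (i div 2) b (i mod 2), idx4 a (j div 2) b (j mod 2)))"

definition ptrace_A'B' :: "complex mat \<Rightarrow> complex mat" where
  "ptrace_A'B' R = mat 4 4 (\<lambda>(i, j). \<Sum>a'<2. \<Sum>b'<2.
     R $$ (idx4 (i div 2) a' (i mod 2) b', idx4 (j div 2) a' (j mod 2) b'))"

(* Partial transpose of an operator on C^m (x) C^n in the second factor.
   As AA' and BB' are adjacent, T_BB' is the case m = n = 4. *)
definition ptranspose :: "nat \<Rightarrow> nat \<Rightarrow> complex mat \<Rightarrow> complex mat" where
  "ptranspose m n R = mat (m * n) (m * n) (\<lambda>(i, j).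
     R $$ ((i div n) * n + j mod n, (j div n) * n + i mod n))"

definition dual_state :: "superop \<Rightarrow> complex mat \<Rightarrow> bool" where
  "dual_state \<Lambda> R \<longleftrightarrow> psd 16 R \<and> 4 \<cdot>\<^sub>m ptrace_A'B' R = 1\<^sub>m 4 \<and>
     (\<forall>\<rho> \<in> carrier_mat 4 4. transpose_mat (\<Lambda> \<rho>) = 4 \<cdot>\<^sub>m ptrace_AB (R * tensor_I_A'B' \<rho>))"

definition ppt_operation :: "superop \<Rightarrow> bool" where
  "ppt_operation \<Lambda> \<longleftrightarrow> cptp_map 4 4 \<Lambda> \<and> (\<exists>R. dual_state \<Lambda> R \<and> psd 16 (ptranspose 4 4 R))"


section \<open>LOCC operations\<close>

(* A local instrument on C^n with outcomes x < N; on outcome x the output system is C^(m x). *)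
definition instrument :: "nat \<Rightarrow> nat \<Rightarrow> (nat \<Rightarrow> nat) \<Rightarrow> (nat \<Rightarrow> superop) \<Rightarrow> bool" where
  "instrument n N m E \<longleftrightarrow> (\<forall>x<N. 0 < m x \<and> cp_map n (m x) (E x)) \<and>
     (\<forall>X \<in> carrier_mat n n. (\<Sum>x<N. mat_trace (E x X)) = mat_trace X)"

definition mat_sum :: "nat \<Rightarrow> nat \<Rightarrow> (nat \<Rightarrow> complex mat) \<Rightarrow> complex mat" where
  "mat_sum n N F = mat n n (\<lambda>(i, j). \<Sum>x<N. F x $$ (i, j))"

(* locc a' b' a b \<Lambda>: \<Lambda> is realized by a finite tree of local instruments that starts on
   C^a (x) C^b and ends on C^a' (x) C^b'.  In each round one party applies an instrument and
   announces the outcome x; the rest \<Lambda> x of the protocol may depend on x.  The intermediate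
   local dimensions are arbitrary (ancillas may be added or discarded). *)
inductive locc :: "nat \<Rightarrow> nat \<Rightarrow> nat \<Rightarrow> nat \<Rightarrow> superop \<Rightarrow> bool" for a' b' :: nat where
  locc_done: "locc a' b' a' b' (\<lambda>X. X)"
| locc_Alice: "instrument a N m E \<Longrightarrow> \<forall>x<N. locc a' b' (m x) b (\<Lambda> x) \<Longrightarrow>
     locc a' b' a b (\<lambda>X. mat_sum (a' * b') N (\<lambda>x. \<Lambda> x (tensor_id a (m x) b (E x) X)))"
| locc_Bob: "instrument b N m E \<Longrightarrow> \<forall>x<N. locc a' b' a (m x) (\<Lambda> x) \<Longrightarrow>
     locc a' b' a b (\<lambda>X. mat_sum (a' * b') N (\<lambda>x. \<Lambda> x (id_tensor a b (m x) (E x) X)))"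

definition locc_operation :: "superop \<Rightarrow> bool" where
  "locc_operation \<Lambda> \<longleftrightarrow> cptp_map 4 4 \<Lambda> \<and>
     (\<exists>\<Lambda>'. locc 2 2 2 2 \<Lambda>' \<and> (\<forall>X \<in> carrier_mat 4 4. \<Lambda> X = \<Lambda>' X))"

end

(* For a state rho with partial transpose rho^G, every positive Q for which (rho + Q)^G is positive
   bounds the fidelity reachable by a PPT-preserving channel L by (1 + tr Q) / 2: L(rho + Q) has a positive
   partial transpose and trace 1 + tr Q, hence overlap at most (1 + tr Q) / 2 with any maximally entangled
   vector, and L(Q) is positive.  Both PPT-operations and LOCC maps preserve PPT-positivity.

   Conversely, a filter B applied by Bob, followed by a reset to |00> when it fails, reaches the overlap
   1/2 - <u|rho^G|u> / 2 with the Bell vector, where the contraction u is B up to a rotation of the output.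
   Let u minimize <u|rho^G|u> over contractions.  The first-order condition says that N = - rho^G u, read as a
   2 x 2 matrix, is aligned with u; hence the singular vectors of N yield a positive Q with
   (rho + Q)^G u = 0 and tr Q = - <u|rho^G|u>.  The form (rho + Q)^G is positive: it is nonnegative on product
   vectors, and every line in the direction of the entangled vector u, which lies in its kernel, contains a
   product vector.  The two bounds meet. *)

theory Submission
  imports Defs "HOL-Analysis.Topology_Euclidean_Space"
begin

(* Both HOL-Analysis and Jordan_Normal_Form define vec and mat. *)
unbundle no vec_syntax
hide_const (open) Finite_Cartesian_Product.vec Finite_Cartesian_Product.mat

section \<open>Sesquilinear forms\<close>

text \<open>The objective \<open><u|rho^G|u>\<close> is in general indefinite, so the minimization
  over contractions is not convex and stationarity by itself certifies nothing; the certificate is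
  Q. On the ball of contractions, the maximum of Re \<open><f, N>\<close> is the trace norm of N.
  The first-order condition says that u attains it, and equality forces u to carry each right
  singular vector of N with nonzero singular value to the corresponding left one. Q weights the
  product vectors formed from these pairs by the singular values, so tr Q is the trace norm of N.

  Two qubits matter for the positivity of (rho + Q)^G: product vectors are the singular 2 x 2
  matrices, and det (f + z u) is a quadratic polynomial in z with leading coefficient det u. If det
  u = 0, a root may be missing; but then u is itself a product vector, the minimum is 0, Q vanishes
  and rho^G is already positive.

  The optimal map is presented twice: as a separable Kraus family, whose dual state can be written
  down, and as a tree of local instruments. The two agree on 4 x 4 matrices.\<close>

definition sform :: "'i set \<Rightarrow> ('i \<Rightarrow> 'i \<Rightarrow> complex) \<Rightarrow> ('i \<Rightarrow> complex) \<Rightarrow> ('i \<Rightarrow> complex) \<Rightarrow> complex" where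
  "sform I A f g = (\<Sum>i\<in>I. \<Sum>j\<in>I. cnj (f i) * A i j * g j)"

definition pos_form :: "'i set \<Rightarrow> ('i \<Rightarrow> 'i \<Rightarrow> complex) \<Rightarrow> bool" where
  "pos_form I A \<longleftrightarrow> (\<forall>f. 0 \<le> sform I A f f)"

lemma sform_add_left: "sform I A (\<lambda>i. f i + g i) h = sform I A f h + sform I A g h"
  by (simp add: sform_def algebra_simps sum.distrib)

lemma sform_add_right: "sform I A h (\<lambda>i. f i + g i) = sform I A h f + sform I A h g"
  by (simp add: sform_def algebra_simps sum.distrib)

lemma sform_scale_left: "sform I A (\<lambda>i. c * f i) h = cnj c * sform I A f h"
  by (simp add: sform_def algebra_simps sum_distrib_left)

lemma sform_scale_right: "sform I A h (\<lambda>i. c * f i) = c * sform I A h f"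
  by (simp add: sform_def algebra_simps sum_distrib_left)

lemma sform_add_form: "sform I (\<lambda>i j. A i j + B i j) f g = sform I A f g + sform I B f g"
  by (simp add: sform_def algebra_simps sum.distrib)

lemma sform_cong:
  assumes "\<And>i j. i \<in> I \<Longrightarrow> j \<in> I \<Longrightarrow> A i j = B i j" "\<And>i. i \<in> I \<Longrightarrow> f i = f' i" "\<And>i. i \<in> I \<Longrightarrow> g i = g' i"
  shows "sform I A f g = sform I B f' g'"
  unfolding sform_def using assms by (intro sum.cong refl) auto

lemma pos_form_cong:
  assumes "\<And>i j. i \<in> I \<Longrightarrow> j \<in> I \<Longrightarrow> A i j = B i j"
  shows "pos_form I A \<longleftrightarrow> pos_form I B"
proof -
  have "sform I A f f = sform I B f f" for f
    using assms by (rule sform_cong) auto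
  then show ?thesis by (simp add: pos_form_def)
qed

lemma pos_form_add: "pos_form I A \<Longrightarrow> pos_form I B \<Longrightarrow> pos_form I (\<lambda>i j. A i j + B i j)"
  by (simp add: pos_form_def sform_add_form)

lemma pos_form_sum:
  assumes "\<And>k. k \<in> K \<Longrightarrow> pos_form I (A k)"
  shows "pos_form I (\<lambda>i j. \<Sum>k\<in>K. A k i j)"
proof -
  have "sform I (\<lambda>i j. \<Sum>k\<in>K. A k i j) f f = (\<Sum>k\<in>K. sform I (A k) f f)" for f
  proof -
    have "sform I (\<lambda>i j. \<Sum>k\<in>K. A k i j) f f
        = (\<Sum>i\<in>I. \<Sum>j\<in>I. \<Sum>k\<in>K. cnj (f i) * A k i j * f j)"
      by (simp add: sform_def sum_distrib_left sum_distrib_right)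
    also have "\<dots> = (\<Sum>i\<in>I. \<Sum>k\<in>K. \<Sum>j\<in>I. cnj (f i) * A k i j * f j)"
      by (intro sum.cong refl sum.swap)
    also have "\<dots> = (\<Sum>k\<in>K. \<Sum>i\<in>I. \<Sum>j\<in>I. cnj (f i) * A k i j * f j)"
      by (rule sum.swap)
    finally show ?thesis by (simp add: sform_def)
  qed
  then show ?thesis using assms by (auto simp: pos_form_def intro!: sum_nonneg)
qed

lemma cnj_mult_self_nonneg: "0 \<le> cnj z * z"
  by (simp add: less_eq_complex_def)

lemma sform_rank_one:
  "sform I (\<lambda>i j. w i * cnj (w j)) f f = cnj (\<Sum>i\<in>I. cnj (w i) * f i) * (\<Sum>i\<in>I. cnj (w i) * f i)"
  unfolding sform_def cnj_sum sum_product by (simp add: mult_ac)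

lemma pos_form_rank_one: "pos_form I (\<lambda>i j. w i * cnj (w j))"
  by (simp only: pos_form_def sform_rank_one cnj_mult_self_nonneg simp_thms)

lemma pos_form_transpose:
  assumes "pos_form I A" shows "pos_form I (\<lambda>i j. A j i)"
proof -
  have "sform I (\<lambda>i j. A j i) f f = sform I A (\<lambda>i. cnj (f i)) (\<lambda>i. cnj (f i))" for f
    unfolding sform_def by (subst sum.swap) (simp add: mult_ac)
  then show ?thesis using assms by (simp add: pos_form_def)
qed

lemma sform_reindex:
  assumes "bij_betw h I J"
  shows "sform I (\<lambda>i j. A (h i) (h j)) (\<lambda>i. f (h i)) (\<lambda>i. g (h i)) = sform J A f g"
proof -
  have "(\<Sum>j\<in>I. cnj (f (h i)) * A (h i) (h j) * g (h j)) = (\<Sum>j\<in>J. cnj (f (h i)) * A (h i) j * g j)" for i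
    by (rule sum.reindex_bij_betw[OF assms, of "\<lambda>j. cnj (f (h i)) * A (h i) j * g j"])
  then have "sform I (\<lambda>i j. A (h i) (h j)) (\<lambda>i. f (h i)) (\<lambda>i. g (h i))
      = (\<Sum>i\<in>I. \<Sum>j\<in>J. cnj (f (h i)) * A (h i) j * g j)"
    unfolding sform_def by simp
  also have "\<dots> = sform J A f g"
    unfolding sform_def
    by (rule sum.reindex_bij_betw[OF assms, of "\<lambda>i. \<Sum>j\<in>J. cnj (f i) * A i j * g j"])
  finally show ?thesis .
qed

lemma pos_form_reindex:
  assumes "bij_betw h I J"
  shows "pos_form J A \<longleftrightarrow> pos_form I (\<lambda>i j. A (h i) (h j))"
proof
  assume *: "pos_form J A"
  show "pos_form I (\<lambda>i j. A (h i) (h j))"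
    unfolding pos_form_def
  proof
    fix f
    define g where "g j = (f (inv_into I h j) :: complex)" for j
    have "g (h i) = f i" if "i \<in> I" for i
      using assms that by (simp add: g_def bij_betw_def)
    then have "sform I (\<lambda>i j. A (h i) (h j)) f f = sform I (\<lambda>i j. A (h i) (h j)) (\<lambda>i. g (h i)) (\<lambda>i. g (h i))"
      unfolding sform_def by (intro sum.cong refl) simp
    also have "\<dots> = sform J A g g"
      by (rule sform_reindex[OF assms])
    also have "0 \<le> \<dots>" using * by (simp add: pos_form_def)
    finally show "0 \<le> sform I (\<lambda>i j. A (h i) (h j)) f f" .
  qed
next
  assume *: "pos_form I (\<lambda>i j. A (h i) (h j))"
  show "pos_form J A"
    unfolding pos_form_def
  proof
    fix f
    have "sform J A f f = sform I (\<lambda>i j. A (h i) (h j)) (\<lambda>i. f (h i)) (\<lambda>i. f (h i))"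
      by (rule sform_reindex[OF assms, symmetric])
    also have "0 \<le> \<dots>" using * by (simp add: pos_form_def)
    finally show "0 \<le> sform J A f f" .
  qed
qed

lemma sform_delta_left:
  assumes "finite I" "x \<in> I"
  shows "sform I A (\<lambda>i. if i = x then a else 0) g = cnj a * (\<Sum>j\<in>I. A x j * g j)"
proof -
  have "sform I A (\<lambda>i. if i = x then a else 0) g
      = (\<Sum>i\<in>I. if i = x then (\<Sum>j\<in>I. cnj a * A i j * g j) else 0)"
    unfolding sform_def by (intro sum.cong refl) auto
  with assms show ?thesis by (simp add: sum_distrib_left mult_ac)
qed

lemma sform_delta_delta:
  assumes "finite I" "x \<in> I" "y \<in> I"
  shows "sform I A (\<lambda>i. if i = x then a else 0) (\<lambda>i. if i = y then b else 0) = cnj a * A x y * b"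
proof -
  have "(\<Sum>j\<in>I. A x j * (if j = y then b else 0)) = (\<Sum>j\<in>I. if j = y then A x j * b else 0)"
    by (intro sum.cong) auto
  then show ?thesis using assms by (simp add: sform_delta_left)
qed

text \<open>Polarization: a form that is real on every vector is Hermitian. The values at e_x, e_y,
  e_x + e_y and e_x + i e_y suffice to compare the two cross terms.\<close>

lemma pos_form_hermitian:
  assumes "finite I" "pos_form I A" "x \<in> I" "y \<in> I"
  shows "A y x = cnj (A x y)"
proof -
  have q: "0 \<le> cnj a * A x x * a + cnj b * A y x * a + (cnj a * A x y * b + cnj b * A y y * b)" for a b
  proof -
    have "0 \<le> sform I A (\<lambda>i. (if i = x then a else 0) + (if i = y then b else 0))
                 (\<lambda>i. (if i = x then a else 0) + (if i = y then b else 0))"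
      using assms(2) by (simp only: pos_form_def)
    then show ?thesis
      by (simp add: sform_add_left sform_add_right sform_delta_delta assms algebra_simps)
  qed
  show ?thesis
    using q[of 1 0] q[of 0 1] q[of 1 1] q[of 1 \<i>]
    by (auto simp: less_eq_complex_def complex_eq_iff)
qed

lemma sform_hermitian:
  assumes "\<And>i j. i \<in> I \<Longrightarrow> j \<in> I \<Longrightarrow> A j i = cnj (A i j)"
  shows "sform I A f g = cnj (sform I A g f)"
proof -
  have "cnj (sform I A g f) = (\<Sum>i\<in>I. \<Sum>j\<in>I. g i * A j i * cnj (f j))"
    by (simp add: sform_def) (intro sum.cong refl, simp add: assms[symmetric])
  also have "\<dots> = sform I A f g"
    unfolding sform_def by (subst sum.swap) (simp add: mult_ac)
  finally show ?thesis by simp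
qed

lemma pos_form_zero_diag:
  assumes "finite I" "pos_form I A" "x \<in> I" "y \<in> I" "A x x = 0"
  shows "A y x = 0"
proof (rule ccontr)
  assume nz: "A y x \<noteq> 0"
  define n where "n = (cmod (A y x))\<^sup>2"
  have n: "n > 0" using nz by (simp add: n_def)
  \<comment> \<open>Since \<open>A x x\<close> vanishes, the form at e_y + b e_x is affine in t,
    with value \<open>A y y\<close> - 2 t n. This t brings it down to - \<open>A y y\<close> - 2,
    which is negative.\<close>
  define t where "t = (Re (A y y) + 1) / n"
  define b where "b = - of_real t * cnj (A y x)"
  have h: "A x y = cnj (A y x)" using pos_form_hermitian[OF assms(1,2,4,3)] .
  have nn: "A y x * cnj (A y x) = of_real n" by (simp add: n_def complex_norm_square del: of_real_power)
  have "0 \<le> sform I A (\<lambda>i. (if i = y then 1 else 0) + (if i = x then b else 0))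
                 (\<lambda>i. (if i = y then 1 else 0) + (if i = x then b else 0))"
    using assms(2) by (simp only: pos_form_def)
  also have "\<dots> = A y y + A y x * b + cnj b * A x y"
    by (simp add: sform_add_left sform_add_right sform_delta_delta assms algebra_simps)
  also have "\<dots> = A y y - 2 * of_real (t * n)"
    by (simp add: b_def h nn[symmetric] algebra_simps)
  finally have "0 \<le> Re (A y y) - 2 * (t * n)" by (simp add: less_eq_complex_def)
  moreover have "t * n = Re (A y y) + 1" using n by (simp add: t_def)
  moreover have "0 \<le> sform I A (\<lambda>i. if i = y then 1 else 0) (\<lambda>i. if i = y then 1 else 0)"
    using assms(2) by (simp only: pos_form_def)
  then have "0 \<le> Re (A y y)" by (simp add: sform_delta_delta assms less_eq_complex_def)
  ultimately show False by simp
qed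

lemma sform_insert:
  assumes "finite F" "x \<notin> F"
  shows "sform (insert x F) A f g = cnj (f x) * A x x * g x + cnj (f x) * (\<Sum>j\<in>F. A x j * g j)
    + (\<Sum>i\<in>F. cnj (f i) * A i x) * g x + sform F A f g"
  using assms by (simp add: sform_def sum.distrib sum_distrib_left sum_distrib_right mult_ac)

text \<open>The Cholesky factorization: one Schur complement per step.\<close>

lemma pos_form_decomp:
  assumes "finite I" "pos_form I A"
  shows "\<exists>w. \<forall>i\<in>I. \<forall>j\<in>I. A i j = (\<Sum>k\<in>I. w k i * cnj (w k j))"
  using assms
proof (induction I arbitrary: A rule: finite_induct)
  case empty
  then show ?case by simp
next
  case (insert x F)
  let ?I = "insert x F"
  define p where "p = Re (A x x)"
  have fin: "finite ?I" using insert by simp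
  note herm = pos_form_hermitian[OF fin insert.prems]
  have "0 \<le> sform ?I A (\<lambda>i. if i = x then 1 else 0) (\<lambda>i. if i = x then 1 else 0)"
    using insert.prems by (simp only: pos_form_def)
  then have p: "A x x = of_real p" "0 \<le> p"
    using fin by (auto simp: sform_delta_delta less_eq_complex_def p_def complex_eq_iff)
  \<comment> \<open>The Schur complement. For p = 0 the quotient is 0 by the convention for division
    by zero, which is consistent: row and column of \<open>x\<close> vanish in that case.\<close>
  define A' where "A' i j = A i j - A i x * A x j / of_real p" for i j
  have "pos_form F A'"
    unfolding pos_form_def
  proof
    fix f
    define S where "S = (\<Sum>j\<in>F. A x j * f j)"
    have cS: "(\<Sum>i\<in>F. cnj (f i) * A i x) = cnj S"
      using insert.hyps(1) by (simp add: S_def herm[symmetric] mult_ac)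
    have e: "sform F A' f f = sform F A f f - cnj S * S / of_real p"
      unfolding cS[symmetric] unfolding S_def sform_def A'_def sum_product sum_divide_distrib
      by (simp add: algebra_simps sum_subtractf)
    show "0 \<le> sform F A' f f"
    proof (cases "p = 0")
      case True
      have "0 \<le> sform ?I A (f(x := 0)) (f(x := 0))"
        using insert.prems by (simp only: pos_form_def)
      also have "\<dots> = sform F A (f(x := 0)) (f(x := 0))"
        using insert.hyps by (simp add: sform_insert)
      also have "\<dots> = sform F A f f"
        by (rule sform_cong) (use insert.hyps in auto)
      finally show ?thesis using e True by simp
    next
      case False
      \<comment> \<open>The coordinate at \<open>x\<close> that minimizes the form with the others
        fixed; completing the square leaves the Schur complement.\<close>
      define g where "g = f(x := - S / of_real p)"
      have g: "g i = f i" if "i \<in> F" for i using that insert.hyps by (auto simp: g_def)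
      have "0 \<le> sform ?I A g g"
        using insert.prems by (simp only: pos_form_def)
      also have "\<dots> = cnj (g x) * of_real p * g x + cnj (g x) * S + cnj S * g x + sform F A f f"
      proof -
        have "(\<Sum>j\<in>F. A x j * g j) = S" "(\<Sum>i\<in>F. cnj (g i) * A i x) = cnj S"
          unfolding cS[symmetric] by (auto simp: S_def g intro!: sum.cong)
        moreover have "sform F A g g = sform F A f f" by (rule sform_cong) (auto simp: g)
        ultimately show ?thesis using insert.hyps by (simp add: sform_insert p)
      qed
      also have "\<dots> = sform F A' f f"
      proof -
        define T where "T = S / of_real p"
        have S: "S = T * of_real p" and "g x = - T" using False by (simp_all add: T_def g_def)
        moreover have "cnj S * S / of_real p = cnj T * T * of_real p" using False by (simp add: S)
        ultimately show ?thesis unfolding e by (simp add: algebra_simps)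
      qed
      finally show ?thesis .
    qed
  qed
  then have "\<exists>w. \<forall>i\<in>F. \<forall>j\<in>F. A' i j = (\<Sum>k\<in>F. w k i * cnj (w k j))"
    by (rule insert.IH)
  then obtain w where "\<forall>i\<in>F. \<forall>j\<in>F. A' i j = (\<Sum>k\<in>F. w k i * cnj (w k j))" ..
  then have w: "A' i j = (\<Sum>k\<in>F. w k i * cnj (w k j))" if "i \<in> F" "j \<in> F" for i j
    using that by simp
  \<comment> \<open>The new vector is the column of \<open>x\<close> over sqrt p; the vectors of the
    smaller factorization are extended by 0 at \<open>x\<close>.\<close>
  define v where "v k i = (if k = x then A i x / of_real (sqrt p) else if i = x then 0 else w k i)" for k i
  have sp: "of_real (sqrt p) * of_real (sqrt p) = (of_real p :: complex)"
    by (subst of_real_mult[symmetric]) (simp only: real_sqrt_mult_self abs_of_nonneg[OF p(2)])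
  have zero: "A i x = 0" if "p = 0" "i \<in> ?I" for i
    using pos_form_zero_diag[OF fin insert.prems, of x i] that p by simp
  have zero_row: "A x i = 0" if "p = 0" "i \<in> ?I" for i
    using herm[of i x] zero[OF that] that by simp
  have "A i j = (\<Sum>k\<in>?I. v k i * cnj (v k j))" if ij: "i \<in> ?I" "j \<in> ?I" for i j
  proof -
    have vx: "v x i * cnj (v x j) = A i x * A x j / of_real p"
    proof -
      have "v x i * cnj (v x j) = (A i x * cnj (A j x)) / (of_real (sqrt p) * of_real (sqrt p))"
        by (simp add: v_def)
      also have "cnj (A j x) = A x j" using herm[of j x] ij by simp
      finally show ?thesis by (simp only: sp)
    qed
    have vF: "(\<Sum>k\<in>F. v k i * cnj (v k j)) = A i j - A i x * A x j / of_real p"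
    proof (cases "i = x \<or> j = x")
      case True
      then have "A i x * A x j / of_real p = A i j"
        using p(1) zero[of i] zero_row[of j] ij by (cases "p = 0") auto
      moreover have "(\<Sum>k\<in>F. v k i * cnj (v k j)) = 0"
        using True insert.hyps by (intro sum.neutral) (auto simp: v_def)
      ultimately show ?thesis by simp
    next
      case False
      then have "v k i = w k i \<and> v k j = w k j" if "k \<in> F" for k
        using insert.hyps(2) that by (auto simp: v_def)
      then have "(\<Sum>k\<in>F. v k i * cnj (v k j)) = (\<Sum>k\<in>F. w k i * cnj (w k j))" by simp
      also have "\<dots> = A' i j" using False ij by (intro w[symmetric]) auto
      finally show ?thesis by (simp only: A'_def)
    qed
    show ?thesis using insert.hyps vx vF by simp
  qed
  then show ?case by blast
qed

section \<open>Contractions of a qubit\<close>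

declare One_nat_def [simp del]

section \<open>Two-qubit vectors as 2 x 2 matrices: product vectors and partial
  transposition\<close>

lemma less_2_iff: "(i::nat) < 2 \<longleftrightarrow> i = 0 \<or> i = 1"
  by auto

abbreviation qubits :: "(nat \<times> nat) set" where
  "qubits \<equiv> {..<2} \<times> {..<2}"

text \<open>Partial transpose in the second factor. Indexing entries by pairs keeps it independent
  of the local dimensions, which vary along a protocol.\<close>

definition pt :: "('a \<times> 'b \<Rightarrow> 'a \<times> 'b \<Rightarrow> complex) \<Rightarrow> 'a \<times> 'b \<Rightarrow> 'a \<times> 'b \<Rightarrow> complex" where
  "pt W p q = W (fst p, snd q) (fst q, snd p)"

lemma sum_lessThan_2: "(\<Sum>i<(2::nat). f i) = f 0 + (f 1 :: 'a :: comm_monoid_add)"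
  by (simp add: numeral_2_eq_2 One_nat_def)

lemma sum_qubits: "(\<Sum>p\<in>qubits. f p) = f (0,0) + f (0,1) + f (1,0) + (f (1,1) :: 'a :: comm_monoid_add)"
proof -
  have "qubits = {(0,0), (0,1), (1,0), (1,1)}" by (auto simp: less_2_iff)
  then show ?thesis by (simp add: add.assoc)
qed

text \<open>On a product vector, transposing the second factor of the operator amounts to
  conjugating the second factor of the vector. Partial transposes of positive forms are therefore
  nonnegative there.\<close>

lemma sform_pt_product:
  assumes "\<And>i j. i < 2 \<Longrightarrow> j < 2 \<Longrightarrow> f (i,j) = a i * b j"
  shows "sform qubits (pt R) f f = sform qubits R (\<lambda>(i,j). a i * cnj (b j)) (\<lambda>(i,j). a i * cnj (b j))"
  using assms[of 0 0] assms[of 0 1] assms[of 1 0] assms[of 1 1]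
  by (simp add: sform_def sum_qubits pt_def algebra_simps)

text \<open>A singular 2 x 2 matrix has rank at most one: the second row is a multiple of the first
  unless the first is zero.\<close>

lemma det_zero_product:
  fixes f :: "nat \<times> nat \<Rightarrow> complex"
  assumes "f (0,0) * f (1,1) = f (0,1) * f (1,0)"
  obtains a b where "\<And>i j. i < 2 \<Longrightarrow> j < 2 \<Longrightarrow> f (i,j) = a i * b j"
proof -
  consider (a) "f (0,0) \<noteq> 0 \<or> f (0,1) \<noteq> 0" | (b) "f (0,0) = 0" "f (0,1) = 0" by blast
  then show ?thesis
  proof cases
    case b
    then show ?thesis
      by (intro that[of "\<lambda>i. if i = 0 then 0 else 1" "\<lambda>j. f (1,j)"]) (auto simp: less_2_iff)
  next
    case a
    define c where "c = (if f (0,0) \<noteq> 0 then f (1,0) / f (0,0) else f (1,1) / f (0,1))"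
    have "f (1,0) = c * f (0,0)" "f (1,1) = c * f (0,1)"
      using a assms by (auto simp: c_def field_simps)
    then show ?thesis
      by (intro that[of "\<lambda>i. if i = 0 then 1 else c" "\<lambda>j. f (0,j)"]) (auto simp: less_2_iff)
  qed
qed

lemma pos_form_pt_det_zero:
  assumes "pos_form qubits R" "f (0,0) * f (1,1) = f (0,1) * f (1,0)"
  shows "0 \<le> sform qubits (pt R) f f"
proof -
  obtain a b where "\<And>i j. i < 2 \<Longrightarrow> j < 2 \<Longrightarrow> f (i,j) = a i * b j"
    using det_zero_product[OF assms(2)] by blast
  then show ?thesis using assms(1) by (simp add: sform_pt_product pos_form_def)
qed

text \<open>The homogeneous version allows a vanishing leading coefficient, as can happen in the
  search for singular vectors. The last clause recovers an affine root, as needed on a line in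
  direction \<open>u\<close>.\<close>

lemma complex_quadratic_form_root:
  fixes \<alpha> \<beta> \<gamma> :: complex
  obtains x y where "x \<noteq> 0 \<or> y \<noteq> 0" "\<alpha> * x\<^sup>2 + \<beta> * x * y + \<gamma> * y\<^sup>2 = 0" "\<alpha> \<noteq> 0 \<Longrightarrow> y = 1"
proof (cases "\<alpha> = 0")
  case True
  then show ?thesis by (intro that[of 1 0]) auto
next
  case False
  define s where "s = csqrt (\<beta>\<^sup>2 - 4 * \<alpha> * \<gamma>)"
  have s: "s * s = \<beta>\<^sup>2 - 4 * \<alpha> * \<gamma>" by (simp add: s_def flip: power2_eq_square)
  define x where "x = (s - \<beta>) / (2 * \<alpha>)"
  have "2 * \<alpha> * x + \<beta> = s" using False by (simp add: x_def)
  then have "(2 * \<alpha> * x + \<beta>) * (2 * \<alpha> * x + \<beta>) = \<beta>\<^sup>2 - 4 * \<alpha> * \<gamma>" using s by simp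
  then have "4 * \<alpha> * (\<alpha> * x\<^sup>2 + \<beta> * x * 1 + \<gamma> * 1\<^sup>2) = 0"
    by (simp add: power2_eq_square algebra_simps)
  then show ?thesis using False by (intro that[of x 1]) auto
qed

section \<open>The unit ball of the operator norm on 2 x 2 matrices\<close>

definition contraction2 :: "(nat \<times> nat \<Rightarrow> complex) \<Rightarrow> bool" where
  "contraction2 u \<longleftrightarrow> (\<forall>x y. (cmod (u (0,0) * x + u (0,1) * y))\<^sup>2 + (cmod (u (1,0) * x + u (1,1) * y))\<^sup>2
     \<le> (cmod x)\<^sup>2 + (cmod y)\<^sup>2)"

lemma contraction2_entry_le:
  assumes "contraction2 u" "i < 2" "j < 2"
  shows "cmod (u (i,j)) \<le> 1"
proof -
  have "(cmod (u (0,0)))\<^sup>2 + (cmod (u (1,0)))\<^sup>2 \<le> 1" "(cmod (u (0,1)))\<^sup>2 + (cmod (u (1,1)))\<^sup>2 \<le> 1"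
    using assms(1)[unfolded contraction2_def, rule_format, of 1 0]
      assms(1)[unfolded contraction2_def, rule_format, of 0 1] by simp_all
  moreover have "r \<le> 1\<^sup>2 \<and> s \<le> 1\<^sup>2" if "r + s \<le> 1" "0 \<le> r" "0 \<le> s" for r s :: real
    using that by simp
  ultimately have "(cmod (u (0,0)))\<^sup>2 \<le> 1\<^sup>2 \<and> (cmod (u (1,0)))\<^sup>2 \<le> 1\<^sup>2"
    "(cmod (u (0,1)))\<^sup>2 \<le> 1\<^sup>2 \<and> (cmod (u (1,1)))\<^sup>2 \<le> 1\<^sup>2"
    by (metis zero_le_power2)+
  then have "(cmod (u (i,j)))\<^sup>2 \<le> 1\<^sup>2"
    using assms(2,3) by (auto simp: less_2_iff)
  then show ?thesis by (rule power2_le_imp_le) simp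
qed

lemma cmod_power2_convex:
  assumes "0 \<le> e" "e \<le> 1"
  shows "(cmod (of_real (1 - e) * a + of_real e * b))\<^sup>2 \<le> (1 - e) * (cmod a)\<^sup>2 + e * (cmod b)\<^sup>2"
proof -
  have "(1 - e) * (cmod a)\<^sup>2 + e * (cmod b)\<^sup>2 - (cmod (of_real (1 - e) * a + of_real e * b))\<^sup>2
      = (1 - e) * e * (cmod (a - b))\<^sup>2"
    unfolding cmod_power2 by (simp add: power2_eq_square algebra_simps)
  moreover have "0 \<le> (1 - e) * e * (cmod (a - b))\<^sup>2" using assms by simp
  ultimately show ?thesis by linarith
qed

lemma contraction2_convex:
  assumes "contraction2 u" "contraction2 v" "0 \<le> e" "e \<le> 1"
  shows "contraction2 (\<lambda>p. of_real (1 - e) * u p + of_real e * v p)"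
  unfolding contraction2_def
proof (intro allI)
  fix x y
  have *: "(cmod ((of_real (1 - e) * u (i,0) + of_real e * v (i,0)) * x + (of_real (1 - e) * u (i,1) + of_real e * v (i,1)) * y))\<^sup>2
     \<le> (1 - e) * (cmod (u (i,0) * x + u (i,1) * y))\<^sup>2 + e * (cmod (v (i,0) * x + v (i,1) * y))\<^sup>2" for i
    using cmod_power2_convex[OF assms(3,4), of "u (i,0) * x + u (i,1) * y" "v (i,0) * x + v (i,1) * y"]
    by (simp add: algebra_simps)
  have "(1 - e) * ((cmod (u (0,0) * x + u (0,1) * y))\<^sup>2 + (cmod (u (1,0) * x + u (1,1) * y))\<^sup>2)
    \<le> (1 - e) * ((cmod x)\<^sup>2 + (cmod y)\<^sup>2)"
    using assms by (intro mult_left_mono) (auto simp: contraction2_def)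
  moreover have "e * ((cmod (v (0,0) * x + v (0,1) * y))\<^sup>2 + (cmod (v (1,0) * x + v (1,1) * y))\<^sup>2)
    \<le> e * ((cmod x)\<^sup>2 + (cmod y)\<^sup>2)"
    using assms by (intro mult_left_mono) (auto simp: contraction2_def)
  ultimately show "(cmod ((of_real (1 - e) * u (0,0) + of_real e * v (0,0)) * x + (of_real (1 - e) * u (0,1) + of_real e * v (0,1)) * y))\<^sup>2
    + (cmod ((of_real (1 - e) * u (1,0) + of_real e * v (1,0)) * x + (of_real (1 - e) * u (1,1) + of_real e * v (1,1)) * y))\<^sup>2
    \<le> (cmod x)\<^sup>2 + (cmod y)\<^sup>2"
    using *[of 0] *[of 1] by (simp add: algebra_simps)
qed

text \<open>By homogeneity, a form that is nonnegative on contractions is nonnegative everywhere.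
  The factor is crude: 2 \<open>M\<close> bounds the squared operator norm, and the summand 1 in
  \<open>M\<close> keeps it positive for \<open>v\<close> = 0.\<close>

lemma contraction2_scale:
  fixes v :: "nat \<times> nat \<Rightarrow> complex"
  obtains e :: real where "0 < e" "contraction2 (\<lambda>p. of_real e * v p)"
proof -
  define M where "M = 1 + (cmod (v (0,0)))\<^sup>2 + (cmod (v (0,1)))\<^sup>2 + (cmod (v (1,0)))\<^sup>2 + (cmod (v (1,1)))\<^sup>2"
  define e where "e = 1 / sqrt (2 * M)"
  have M: "M > 0" unfolding M_def by (smt (verit) zero_le_power2)
  have e2: "e\<^sup>2 = 1 / (2 * M)" using M by (simp add: e_def power_divide)
  have sq: "(cmod (a * x + b * y))\<^sup>2 \<le> 2 * ((cmod a)\<^sup>2 * (cmod x)\<^sup>2 + (cmod b)\<^sup>2 * (cmod y)\<^sup>2)" for a b x y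
  proof -
    have "(cmod (a * x + b * y))\<^sup>2 \<le> (cmod a * cmod x + cmod b * cmod y)\<^sup>2"
      by (intro power_mono) (use norm_triangle_ineq[of "a * x" "b * y"] in \<open>auto simp: norm_mult\<close>)
    also have "\<dots> \<le> 2 * ((cmod a)\<^sup>2 * (cmod x)\<^sup>2 + (cmod b)\<^sup>2 * (cmod y)\<^sup>2)"
      using zero_le_power2[of "cmod a * cmod x - cmod b * cmod y"]
      by (simp add: power2_eq_square algebra_simps)
    finally show ?thesis .
  qed
  have "contraction2 (\<lambda>p. of_real e * v p)"
    unfolding contraction2_def
  proof (intro allI)
    fix x y
    have h: "(cmod (of_real e * v (i,0) * x + of_real e * v (i,1) * y))\<^sup>2
       = e\<^sup>2 * (cmod (v (i,0) * x + v (i,1) * y))\<^sup>2" for i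
    proof -
      have "of_real e * v (i,0) * x + of_real e * v (i,1) * y = of_real e * (v (i,0) * x + v (i,1) * y)"
        by (simp add: algebra_simps)
      then show ?thesis by (simp add: norm_mult power_mult_distrib)
    qed
    have "(cmod (v (0,0) * x + v (0,1) * y))\<^sup>2 + (cmod (v (1,0) * x + v (1,1) * y))\<^sup>2
      \<le> 2 * (((cmod (v (0,0)))\<^sup>2 + (cmod (v (1,0)))\<^sup>2) * (cmod x)\<^sup>2 + ((cmod (v (0,1)))\<^sup>2 + (cmod (v (1,1)))\<^sup>2) * (cmod y)\<^sup>2)"
      using sq[of "v (0,0)" x "v (0,1)" y] sq[of "v (1,0)" x "v (1,1)" y] by (simp add: algebra_simps)
    also have "\<dots> \<le> 2 * (M * (cmod x)\<^sup>2 + M * (cmod y)\<^sup>2)"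
    proof -
      have "(cmod (v (0,0)))\<^sup>2 + (cmod (v (1,0)))\<^sup>2 \<le> M" "(cmod (v (0,1)))\<^sup>2 + (cmod (v (1,1)))\<^sup>2 \<le> M"
        by (simp_all add: M_def)
      then show ?thesis by (simp only: mult_left_mono add_mono mult_right_mono zero_le_power2 zero_le_numeral)
    qed
    finally have "e\<^sup>2 * ((cmod (v (0,0) * x + v (0,1) * y))\<^sup>2 + (cmod (v (1,0) * x + v (1,1) * y))\<^sup>2)
      \<le> e\<^sup>2 * (2 * (M * (cmod x)\<^sup>2 + M * (cmod y)\<^sup>2))" by (rule mult_left_mono) simp
    also have "\<dots> = (cmod x)\<^sup>2 + (cmod y)\<^sup>2" using M by (simp add: e2 field_simps)
    finally show "(cmod (of_real e * v (0,0) * x + of_real e * v (0,1) * y))\<^sup>2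
      + (cmod (of_real e * v (1,0) * x + of_real e * v (1,1) * y))\<^sup>2 \<le> (cmod x)\<^sup>2 + (cmod y)\<^sup>2"
      by (simp only: h distrib_left)
  qed
  moreover have "0 < e" using M by (simp add: e_def)
  ultimately show ?thesis by (rule that[rotated])
qed

lemma contraction2_minimizer:
  obtains u where "contraction2 u"
    "\<And>v. contraction2 v \<Longrightarrow> Re (sform qubits W u u) \<le> Re (sform qubits W v v)"
proof -
  \<comment> \<open>Only the four entries on \<open>qubits\<close> are constrained by
    \<open>contraction2\<close>. Quadruples record just these, so the ball becomes a compact
    set.\<close>
  define mk :: "complex \<times> complex \<times> complex \<times> complex \<Rightarrow> nat \<times> nat \<Rightarrow> complex" where
    "mk t p = (if p = (0,0) then fst t else if p = (0,1) then fst (snd t)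
       else if p = (1,0) then fst (snd (snd t)) else snd (snd (snd t)))" for t p
  have mk: "mk t (0,0) = fst t" "mk t (0,1) = fst (snd t)" "mk t (1,0) = fst (snd (snd t))" 
     "mk t (1,1) = snd (snd (snd t))" for t by (simp_all add: mk_def)
  define K where "K = {t. contraction2 (mk t)}"
  \<comment> \<open>Each pair x, y contributes one closed condition on the entries, and the ball is
    their intersection.\<close>
  have "K = (\<Inter>x y. {t. (cmod (mk t (0,0) * x + mk t (0,1) * y))\<^sup>2 + (cmod (mk t (1,0) * x + mk t (1,1) * y))\<^sup>2
     \<le> (cmod x)\<^sup>2 + (cmod y)\<^sup>2})"
    by (auto simp: K_def contraction2_def)
  also have "closed \<dots>"
    unfolding mk by (intro closed_INT ballI closed_Collect_le continuous_intros)
  finally have closed: "closed K" .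
  have subset: "K \<subseteq> cball 0 1 \<times> cball 0 1 \<times> cball 0 1 \<times> cball 0 1"
  proof
    fix t assume "t \<in> K"
    then have "contraction2 (mk t)" by (simp add: K_def)
    from contraction2_entry_le[OF this, of 0 0] contraction2_entry_le[OF this, of 0 1]
      contraction2_entry_le[OF this, of 1 0] contraction2_entry_le[OF this, of 1 1]
    show "t \<in> cball 0 1 \<times> cball 0 1 \<times> cball 0 1 \<times> cball 0 1"
      by (cases t) (simp add: mk)
  qed
  have "compact (cball 0 1 \<times> cball 0 1 \<times> cball 0 1 \<times> cball 0 1 :: (complex \<times> complex \<times> complex \<times> complex) set)"
    by (intro compact_Times compact_cball)
  from closed_Int_compact[OF closed this] subset have "compact K" by (simp add: inf.absorb1)
  moreover have "(0,0,0,0) \<in> K" by (simp add: K_def contraction2_def mk)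
  moreover have "continuous_on K (\<lambda>t. Re (sform qubits W (mk t) (mk t)))"
    unfolding sform_def sum_qubits mk by (intro continuous_intros)
  ultimately obtain t where t: "t \<in> K"
    "\<And>s. s \<in> K \<Longrightarrow> Re (sform qubits W (mk t) (mk t)) \<le> Re (sform qubits W (mk s) (mk s))"
    using continuous_attains_inf[of K] by blast
  show ?thesis
  proof (rule that[of "mk t"])
    show "contraction2 (mk t)" using t by (simp add: K_def)
    fix v assume v: "contraction2 v"
    define s where "s = (v (0,0), v (0,1), v (1,0), v (1,1))"
    have "mk s p = v p" if "p \<in> qubits" for p
      using that by (auto simp: less_2_iff mk s_def)
    then have "sform qubits W (mk s) (mk s) = sform qubits W v v" 
      by (intro sform_cong) auto
    moreover have "s \<in> K" using v by (simp add: K_def contraction2_def mk s_def)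
    ultimately show "Re (sform qubits W (mk t) (mk t)) \<le> Re (sform qubits W v v)" using t(2)[of s] by simp
  qed
qed


section \<open>Singular value decomposition of a 2 x 2 matrix\<close>

lemma svd2_right_vectors:
  fixes N :: "nat \<times> nat \<Rightarrow> complex"
  obtains x y where "(cmod x)\<^sup>2 + (cmod y)\<^sup>2 = 1"
    "cnj (N (0,0) * x + N (0,1) * y) * (N (0,1) * cnj x - N (0,0) * cnj y)
     + cnj (N (1,0) * x + N (1,1) * y) * (N (1,1) * cnj x - N (1,0) * cnj y) = 0"
proof -
  let ?\<alpha> = "N (0,0) * cnj (N (0,1)) + N (1,0) * cnj (N (1,1))"
  let ?\<beta> = "N (0,1) * cnj (N (0,1)) + N (1,1) * cnj (N (1,1)) - N (0,0) * cnj (N (0,0)) - N (1,0) * cnj (N (1,0))"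
  let ?\<gamma> = "- N (0,1) * cnj (N (0,0)) - N (1,1) * cnj (N (1,0))"
  \<comment> \<open>A right singular vector (x, y) is one whose image under \<open>N\<close> is
    orthogonal to the image of (- cnj y, cnj x). The conjugate of this condition contains x and y
    without bars, hence is a binary quadratic form; its zeros can be normalized by
    homogeneity.\<close>
  obtain x y where xy: "x \<noteq> 0 \<or> y \<noteq> 0" "?\<alpha> * x\<^sup>2 + ?\<beta> * x * y + ?\<gamma> * y\<^sup>2 = 0"
    by (rule complex_quadratic_form_root)
  have eq: "(N (0,0) * x + N (0,1) * y) * (cnj (N (0,1)) * x - cnj (N (0,0)) * y)
     + (N (1,0) * x + N (1,1) * y) * (cnj (N (1,1)) * x - cnj (N (1,0)) * y) = 0"
    using xy(2) by (simp add: power2_eq_square algebra_simps)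
  define r where "r = sqrt ((cmod x)\<^sup>2 + (cmod y)\<^sup>2)"
  have r: "r > 0" using xy(1) by (auto simp: r_def intro: add_pos_nonneg add_nonneg_pos)
  have r2: "r\<^sup>2 = (cmod x)\<^sup>2 + (cmod y)\<^sup>2" by (simp add: r_def)
  define x' y' where "x' = x / of_real r" and "y' = y / of_real r"
  have x: "x = of_real r * x'" and y: "y = of_real r * y'" using r by (simp_all add: x'_def y'_def)
  have "r\<^sup>2 * ((cmod x')\<^sup>2 + (cmod y')\<^sup>2) = r\<^sup>2 * 1"
    using r2 r by (simp add: x y norm_mult power_mult_distrib algebra_simps)
  then have 1: "(cmod x')\<^sup>2 + (cmod y')\<^sup>2 = 1" using r by simp
  have "(of_real r * of_real r) * ((N (0,0) * x' + N (0,1) * y') * (cnj (N (0,1)) * x' - cnj (N (0,0)) * y')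
     + (N (1,0) * x' + N (1,1) * y') * (cnj (N (1,1)) * x' - cnj (N (1,0)) * y')) = 0"
    using eq by (simp add: x y algebra_simps)
  then have "(N (0,0) * x' + N (0,1) * y') * (cnj (N (0,1)) * x' - cnj (N (0,0)) * y')
     + (N (1,0) * x' + N (1,1) * y') * (cnj (N (1,1)) * x' - cnj (N (1,0)) * y') = 0" using r by simp
  then have "cnj ((N (0,0) * x' + N (0,1) * y') * (cnj (N (0,1)) * x' - cnj (N (0,0)) * y')
     + (N (1,0) * x' + N (1,1) * y') * (cnj (N (1,1)) * x' - cnj (N (1,0)) * y')) = 0" by simp
  then have 2: "cnj (N (0,0) * x' + N (0,1) * y') * (N (0,1) * cnj x' - N (0,0) * cnj y')
     + cnj (N (1,0) * x' + N (1,1) * y') * (N (1,1) * cnj x' - N (1,0) * cnj y') = 0" by simp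
  from 1 2 show ?thesis by (rule that)
qed

lemma cmod_power2_mult_cnj: "complex_of_real ((cmod z)\<^sup>2) = z * cnj z"
  by (rule complex_norm_square)

text \<open>\<open>t\<close> sends the orthonormal basis (x, y), (- cnj y, cnj x) to the orthogonal
  vectors \<open>a\<close> and \<open>b\<close>, and z, w are the coordinates in that basis. Norms
  below 1 are allowed so that zero singular values fit in.\<close>

lemma contraction2_orthonormal:
  assumes "(cmod x)\<^sup>2 + (cmod y)\<^sup>2 = 1"
    and a: "(cmod (a (0::nat)))\<^sup>2 + (cmod (a 1))\<^sup>2 \<le> 1" "(cmod (b (0::nat)))\<^sup>2 + (cmod (b 1))\<^sup>2 \<le> 1"
    and orth: "cnj (a 0) * b 0 + cnj (a 1) * b 1 = 0"
    and t: "\<And>i j. t (i,j) = a i * (if j = 0 then cnj x else cnj y) + b i * (if j = 0 then - y else x)"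
  shows "contraction2 t"
  unfolding contraction2_def
proof (intro allI)
  fix X Y
  define z w where "z = cnj x * X + cnj y * Y" and "w = - y * X + x * Y"
  have nm: "(cmod z)\<^sup>2 + (cmod w)\<^sup>2 = (cmod X)\<^sup>2 + (cmod Y)\<^sup>2"
  proof -
    have "(cmod z)\<^sup>2 + (cmod w)\<^sup>2 = ((cmod x)\<^sup>2 + (cmod y)\<^sup>2) * ((cmod X)\<^sup>2 + (cmod Y)\<^sup>2)"
      unfolding z_def w_def cmod_power2 by (simp add: power2_eq_square algebra_simps)
    then show ?thesis using assms(1) by simp
  qed
  have "(cmod (a 0 * z + b 0 * w))\<^sup>2 + (cmod (a 1 * z + b 1 * w))\<^sup>2
    = ((cmod (a 0))\<^sup>2 + (cmod (a 1))\<^sup>2) * (cmod z)\<^sup>2 + ((cmod (b 0))\<^sup>2 + (cmod (b 1))\<^sup>2) * (cmod w)\<^sup>2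
      + 2 * Re (cnj z * w * (cnj (a 0) * b 0 + cnj (a 1) * b 1))"
    unfolding cmod_power2 by (simp add: power2_eq_square algebra_simps)
  also have "\<dots> \<le> 1 * (cmod z)\<^sup>2 + 1 * (cmod w)\<^sup>2"
  proof -
    have "Re (cnj z * w * (cnj (a 0) * b 0 + cnj (a 1) * b 1)) = 0" by (simp only: orth mult_zero_right zero_complex.simps)
    then show ?thesis using mult_right_mono[OF a(1), of "(cmod z)\<^sup>2"] mult_right_mono[OF a(2), of "(cmod w)\<^sup>2"] by simp
  qed
  finally have "(cmod (a 0 * z + b 0 * w))\<^sup>2 + (cmod (a 1 * z + b 1 * w))\<^sup>2 \<le> (cmod X)\<^sup>2 + (cmod Y)\<^sup>2"
    using nm by simp
  moreover have "(a i * cnj x + b i * (- y)) * X + (a i * cnj y + b i * x) * Y = a i * z + b i * w" for i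
    by (simp add: z_def w_def algebra_simps)
  ultimately show "(cmod (t (0,0) * X + t (0,1) * Y))\<^sup>2 + (cmod (t (1,0) * X + t (1,1) * Y))\<^sup>2
    \<le> (cmod X)\<^sup>2 + (cmod Y)\<^sup>2"
    by (simp only: t if_True if_False refl one_neq_zero)
qed

text \<open>For \<open>n\<close> = 0 the division gives the zero vector. The factorization of
  \<open>c\<close> thus holds in every case, at the price that \<open>a\<close> may have norm 0
  instead of 1.\<close>

lemma normalized2:
  fixes c :: "nat \<Rightarrow> complex"
  defines "n \<equiv> sqrt ((cmod (c 0))\<^sup>2 + (cmod (c 1))\<^sup>2)"
  defines "a \<equiv> (\<lambda>i. c i / complex_of_real n)"
  shows "0 \<le> n" "i < 2 \<Longrightarrow> c i = of_real n * a i"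
    "(cmod (a 0))\<^sup>2 + (cmod (a 1))\<^sup>2 \<le> 1" "n \<noteq> 0 \<Longrightarrow> (cmod (a 0))\<^sup>2 + (cmod (a 1))\<^sup>2 = 1"
    "n = 0 \<Longrightarrow> a i = 0"
proof -
  have n2: "n\<^sup>2 = (cmod (c 0))\<^sup>2 + (cmod (c 1))\<^sup>2" by (simp add: n_def)
  have z: "c 0 = 0 \<and> c 1 = 0" if "n = 0"
    using n2 that by (simp add: add_nonneg_eq_0_iff)
  show one: "(cmod (a 0))\<^sup>2 + (cmod (a 1))\<^sup>2 = 1" if "n \<noteq> 0"
    using that by (simp add: a_def norm_divide power_divide flip: add_divide_distrib n2)
  show "0 \<le> n" by (simp add: n_def)
  show "c i = of_real n * a i" if "i < 2"
    using z that by (cases "n = 0") (auto simp: a_def less_2_iff)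
  show "(cmod (a 0))\<^sup>2 + (cmod (a 1))\<^sup>2 \<le> 1"
    using one by (cases "n = 0") (auto simp: a_def)
  show "n = 0 \<Longrightarrow> a i = 0" by (simp add: a_def)
qed

text \<open>The contraction \<open>t\<close> attains the trace norm of \<open>N\<close>; \<open>a k\<close> is a unit vector only if \<open>n k \<noteq> 0\<close>.\<close>

lemma svd2:
  fixes N :: "nat \<times> nat \<Rightarrow> complex"
  obtains n :: "nat \<Rightarrow> real" and a b :: "nat \<Rightarrow> nat \<Rightarrow> complex" and t where
    "\<And>k. 0 \<le> n k"
    "\<And>k. k < 2 \<Longrightarrow> n k \<noteq> 0 \<Longrightarrow> (cmod (a k 0))\<^sup>2 + (cmod (a k 1))\<^sup>2 = 1"
    "\<And>k. (cmod (b k 0))\<^sup>2 + (cmod (b k 1))\<^sup>2 = 1"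
    "\<And>i j. i < 2 \<Longrightarrow> j < 2 \<Longrightarrow> N (i,j) = (\<Sum>k<2. of_real (n k) * a k i * cnj (b k j))"
    "contraction2 t" "(\<Sum>p\<in>qubits. cnj (t p) * N p) = of_real (n 0 + n 1)"
proof -
  obtain x y where xy: "(cmod x)\<^sup>2 + (cmod y)\<^sup>2 = 1"
    and orth: "cnj (N (0,0) * x + N (0,1) * y) * (N (0,1) * cnj x - N (0,0) * cnj y)
     + cnj (N (1,0) * x + N (1,1) * y) * (N (1,1) * cnj x - N (1,0) * cnj y) = 0"
    by (rule svd2_right_vectors)
  have xy': "x * cnj x + y * cnj y = 1"
  proof -
    have "complex_of_real ((cmod x)\<^sup>2 + (cmod y)\<^sup>2) = 1" by (simp only: xy of_real_1)
    then show ?thesis unfolding of_real_add cmod_power2_mult_cnj .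
  qed
  \<comment> \<open>\<open>c\<close> and \<open>d\<close> are the images under \<open>N\<close> of
    the two right singular vectors (x, y) and (- cnj y, cnj x); their norms \<open>nc\<close> and
    \<open>nd\<close> are the singular values.\<close>
  define c where "c i = N (i,0) * x + N (i,1) * y" for i
  define d where "d i = N (i,1) * cnj x - N (i,0) * cnj y" for i
  define nc where "nc = sqrt ((cmod (c 0))\<^sup>2 + (cmod (c 1))\<^sup>2)"
  define ac where "ac i = c i / complex_of_real nc" for i
  define nd where "nd = sqrt ((cmod (d 0))\<^sup>2 + (cmod (d 1))\<^sup>2)"
  define ad where "ad i = d i / complex_of_real nd" for i
  note c = normalized2[where c = c, folded nc_def, folded ac_def]
  note d = normalized2[where c = d, folded nd_def, folded ad_def]
  have orth': "cnj (ac 0) * ad 0 + cnj (ac 1) * ad 1 = 0"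
    using orth unfolding c_def[symmetric] d_def[symmetric] ac_def ad_def 
    by (simp flip: add_divide_distrib)
  \<comment> \<open>The polar part of \<open>N\<close>: each right singular vector goes to its
    normalized image, or to 0 if that image vanishes.\<close>
  let ?t = "\<lambda>(i,j). ac i * (if j = 0 then cnj x else cnj y) + ad i * (if j = 0 then - y else x)"
  have N: "N (i,0) = c i * cnj x - d i * y" "N (i,1) = c i * cnj y + d i * x" for i
  proof -
    have "c i * cnj x - d i * y = N (i,0) * (x * cnj x + y * cnj y)"
      "c i * cnj y + d i * x = N (i,1) * (x * cnj x + y * cnj y)"
      by (simp_all add: c_def d_def algebra_simps)
    then show "N (i,0) = c i * cnj x - d i * y" "N (i,1) = c i * cnj y + d i * x" by (simp_all add: xy')
  qed
  have cc: "cnj (ac 0) * c 0 + cnj (ac 1) * c 1 = of_real nc"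
  proof (cases "nc = 0")
    case False
    have "cnj (ac 0) * c 0 + cnj (ac 1) * c 1 = of_real nc * of_real ((cmod (ac 0))\<^sup>2 + (cmod (ac 1))\<^sup>2)"
      unfolding of_real_add cmod_power2_mult_cnj using c(2)[of 0] c(2)[of 1] by (simp add: algebra_simps)
    then show ?thesis using c(4)[OF False] by simp
  qed (use c(5) in simp)
  have dd: "cnj (ad 0) * d 0 + cnj (ad 1) * d 1 = of_real nd"
  proof (cases "nd = 0")
    case False
    have "cnj (ad 0) * d 0 + cnj (ad 1) * d 1 = of_real nd * of_real ((cmod (ad 0))\<^sup>2 + (cmod (ad 1))\<^sup>2)"
      unfolding of_real_add cmod_power2_mult_cnj using d(2)[of 0] d(2)[of 1] by (simp add: algebra_simps)
    then show ?thesis using d(4)[OF False] by simp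
  qed (use d(5) in simp)
  show ?thesis
  proof (rule that[of "\<lambda>k. if k = 0 then nc else nd" "\<lambda>k. if k = 0 then ac else ad"
      "\<lambda>k j. if k = 0 then (if j = 0 then x else y) else (if j = 0 then - cnj y else cnj x)" ?t])
    show "contraction2 ?t" by (rule contraction2_orthonormal[OF xy c(3) d(3) orth']) simp
    show "N (i,j) = (\<Sum>k<(2::nat). of_real (if k = 0 then nc else nd) * (if k = 0 then ac else ad) i *
        cnj (if k = 0 then (if j = 0 then x else y) else (if j = 0 then - cnj y else cnj x)))" if "i < 2" "j < 2" for i j
      using that N[of i] c(2)[of i] d(2)[of i] by (auto simp: sum_lessThan_2 less_2_iff)
    have "(\<Sum>p\<in>qubits. cnj (?t p) * N p) = (cnj (ac 0) * c 0 + cnj (ac 1) * c 1 + (cnj (ad 0) * d 0 + cnj (ad 1) * d 1)) * (x * cnj x + y * cnj y)"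
      unfolding sum_qubits by (simp add: N algebra_simps)
    also have "\<dots> = of_real (nc + nd)" by (simp add: cc dd xy')
    finally show "(\<Sum>p\<in>qubits. cnj (?t p) * N p) = of_real ((if 0 = (0::nat) then nc else nd) + (if 1 = (0::nat) then nc else nd))"
      by simp
  qed (use c d xy in \<open>auto simp: add.commute\<close>)
qed


section \<open>First-order optimality and the dual certificate\<close>

lemma contraction2_first_order:
  assumes herm: "\<And>p q. p \<in> qubits \<Longrightarrow> q \<in> qubits \<Longrightarrow> W q p = cnj (W p q)"
    and u: "contraction2 u" "\<And>v. contraction2 v \<Longrightarrow> Re (sform qubits W u u) \<le> Re (sform qubits W v v)"
    and t: "contraction2 t"
  shows "Re (sform qubits W u u) \<le> Re (sform qubits W t u)"
proof (rule ccontr)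
  assume neg: "\<not> ?thesis"
  \<comment> \<open>The segment from \<open>u\<close> to \<open>t\<close> stays in the convex ball.
    Along it the form changes by e (2 s + e G), so a negative slope s contradicts minimality even
    when the form is indefinite.\<close>
  define d where "d p = t p + (- 1) * u p" for p
  define s where "s = Re (sform qubits W d u)"
  have "s = Re (sform qubits W t u) - Re (sform qubits W u u)"
    unfolding s_def d_def[abs_def] sform_add_left sform_scale_left by simp
  with neg have s: "s < 0" by simp
  define G where "G = Re (sform qubits W d d)"
  have *: "0 \<le> e * (2 * s + e * G)" if e: "0 \<le> e" "e \<le> 1" for e
  proof -
    have "sform qubits W u d = cnj (sform qubits W d u)" by (rule sform_hermitian) (rule herm)
    then have "Re (sform qubits W u d) = s" by (simp add: s_def)
    moreover have "sform qubits W (\<lambda>p. u p + of_real e * d p) (\<lambda>p. u p + of_real e * d p)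
      = sform qubits W u u + of_real e * (sform qubits W u d + sform qubits W d u + of_real e * sform qubits W d d)"
      by (simp add: sform_add_left sform_add_right sform_scale_left sform_scale_right algebra_simps)
    ultimately have "Re (sform qubits W (\<lambda>p. u p + of_real e * d p) (\<lambda>p. u p + of_real e * d p))
       = Re (sform qubits W u u) + e * (2 * s + e * G)"
      by (simp add: s_def[symmetric] G_def algebra_simps)
    moreover have "(\<lambda>p. u p + of_real e * d p) = (\<lambda>p. of_real (1 - e) * u p + of_real e * t p)"
      by (simp add: d_def algebra_simps)
    ultimately show ?thesis
      using u(2)[OF contraction2_convex[OF u(1) t e]] by simp
  qed
  \<comment> \<open>Small enough for e G \<le> - s, which leaves 2 s + e G \<le> s < 0.\<close>
  define e where "e = min 1 (- s / (\<bar>G\<bar> + 1))"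
  have e: "0 < e" "e \<le> 1" using s by (auto simp: e_def divide_neg_pos)
  have "e * G \<le> e * (\<bar>G\<bar> + 1)" using e by (intro mult_left_mono) auto
  also have "\<dots> \<le> (- s / (\<bar>G\<bar> + 1)) * (\<bar>G\<bar> + 1)" unfolding e_def by (intro mult_right_mono) auto
  also have "\<dots> = - s" by simp
  finally have "2 * s + e * G < 0" using s by simp
  then have "e * (2 * s + e * G) < 0" using e(1) by (rule mult_pos_neg[rotated])
  with *[of e] e show False by simp
qed

lemma filter_witness_duality:
  assumes R: "pos_form qubits R"
  obtains u Q where "contraction2 u" "pos_form qubits Q" "pos_form qubits (\<lambda>p q. pt R p q + pt Q p q)"
    "(\<Sum>p\<in>qubits. Q p p) = - sform qubits (pt R) u u"
proof -
  obtain u where u: "contraction2 u"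
    and min: "\<And>v. contraction2 v \<Longrightarrow> Re (sform qubits (pt R) u u) \<le> Re (sform qubits (pt R) v v)"
    by (rule contraction2_minimizer) blast
  have hermR: "R q p = cnj (R p q)" if "p \<in> qubits" "q \<in> qubits" for p q
    using pos_form_hermitian[OF _ R that] by simp
  have hermW: "pt R q p = cnj (pt R p q)" if "p \<in> qubits" "q \<in> qubits" for p q
    using that unfolding pt_def by (intro hermR) auto
  \<comment> \<open>Minus half the gradient of the form at \<open>u\<close>: a step in direction f
    lowers the form at rate 2 Re <f, N>.\<close>
  define N where "N p = - (\<Sum>q\<in>qubits. pt R p q * u q)" for p
  have WN: "sform qubits (pt R) f u = - (\<Sum>p\<in>qubits. cnj (f p) * N p)" for f
    by (simp add: sform_def N_def sum_negf sum_distrib_left mult.assoc)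
  obtain n a b t where n: "\<And>k. (0::real) \<le> n k"
    and a: "\<And>k. k < 2 \<Longrightarrow> n k \<noteq> 0 \<Longrightarrow> (cmod (a k 0))\<^sup>2 + (cmod (a k 1))\<^sup>2 = 1"
    and b: "\<And>k::nat. (cmod (b k 0))\<^sup>2 + (cmod (b k 1))\<^sup>2 = 1"
    and N: "\<And>i j. i < 2 \<Longrightarrow> j < 2 \<Longrightarrow> N (i,j) = (\<Sum>k<2. of_real (n k) * a k i * cnj (b k j))"
    and t: "contraction2 t" "(\<Sum>p\<in>qubits. cnj (t p) * N p) = of_real (n 0 + n 1)"
    by (rule svd2[of N]) blast
  define v where "v k i = u (i,0) * b k 0 + u (i,1) * b k 1" for k i
  define c where "c k = cnj (a k 0) * v k 0 + cnj (a k 1) * v k 1" for k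
  have uN: "(\<Sum>p\<in>qubits. cnj (u p) * N p) = (\<Sum>k<2. of_real (n k) * cnj (c k))"
    by (simp add: sum_qubits N sum_lessThan_2 c_def v_def algebra_simps)
  have v1: "(cmod (v k 0))\<^sup>2 + (cmod (v k 1))\<^sup>2 \<le> 1" for k
    using u[unfolded contraction2_def, rule_format, of "b k 0" "b k 1"] b[of k] by (simp add: v_def)
  have dist: "(cmod (v k 0 - a k 0))\<^sup>2 + (cmod (v k 1 - a k 1))\<^sup>2
      = (cmod (v k 0))\<^sup>2 + (cmod (v k 1))\<^sup>2 - 2 * Re (c k) + ((cmod (a k 0))\<^sup>2 + (cmod (a k 1))\<^sup>2)" for k
    unfolding c_def cmod_power2 by (simp add: power2_eq_square algebra_simps)
  have c_le: "n k * Re (c k) \<le> n k" if "k < 2" for k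
  proof (cases "n k = 0")
    case False
    have "0 \<le> (cmod (v k 0 - a k 0))\<^sup>2 + (cmod (v k 1 - a k 1))\<^sup>2" by simp
    then have "Re (c k) \<le> 1" using dist[of k] v1[of k] a[OF that False] by linarith
    then show ?thesis using n[of k] by (simp add: mult_left_le)
  qed simp
  \<comment> \<open>The first-order condition tested with the polar part \<open>t\<close> of
    \<open>N\<close>, where <t, N> is the trace norm. Against the termwise bound \<open>c_le\<close>
    this leaves only equality for each k.\<close>
  have "n 0 + n 1 \<le> n 0 * Re (c 0) + n 1 * Re (c 1)"
    using contraction2_first_order[OF hermW u min t(1)]
    by (simp add: WN t(2) uN sum_lessThan_2)
  note bound = this
  have nc: "n k * Re (c k) = n k" if "k < 2" for k
  proof -
    have "(0::nat) < 2" "(1::nat) < 2" by simp_all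
    note c_le = c_le[OF this(1)] c_le[OF this(2)]
    have "n 0 * Re (c 0) = n 0" "n 1 * Re (c 1) = n 1"
      using bound c_le by linarith+
    then show ?thesis using that unfolding less_2_iff by (elim disjE) simp_all
  qed
  \<comment> \<open>The equality case of Cauchy-Schwarz: \<open>v k\<close> has norm at most 1 and
    \<open>a k\<close> norm 1, so Re (c k) = 1 makes the distance between them zero. That is,
    \<open>u\<close> maps \<open>b k\<close> to \<open>a k\<close>.\<close>
  have c1: "of_real (n k) * c k = of_real (n k)" if "k < 2" for k
  proof (cases "n k = 0")
    case False
    then have "Re (c k) = 1" using nc[OF that] by simp
    then have "(cmod (v k 0 - a k 0))\<^sup>2 + (cmod (v k 1 - a k 1))\<^sup>2 \<le> 0"
      using dist[of k] v1[of k] a[OF that False] by linarith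
    then have "(cmod (v k 0 - a k 0))\<^sup>2 = 0 \<and> (cmod (v k 1 - a k 1))\<^sup>2 = 0"
      by (simp add: sum_power2_le_zero_iff)
    then have "v k 0 = a k 0" "v k 1 = a k 1" by simp_all
    then have "c k = of_real ((cmod (a k 0))\<^sup>2 + (cmod (a k 1))\<^sup>2)"
      unfolding of_real_add cmod_power2_mult_cnj by (simp add: c_def mult.commute)
    then show ?thesis using a[OF that False] by simp
  qed simp
  \<comment> \<open>With \<open>b k\<close> unconjugated here, the partial transpose of
    \<open>Q\<close> applied to \<open>u\<close> contracts \<open>u\<close> with cnj (a k) and
    \<open>b k\<close>. This produces the factors \<open>c k\<close>, hence returns
    \<open>N\<close>.\<close>
  define w where "w k p = of_real (sqrt (n k)) * a k (fst p) * b k (snd p)" for k p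
  define Q where "Q p q = (\<Sum>k<(2::nat). w k p * cnj (w k q))" for p q
  have Q: "pos_form qubits Q"
    unfolding Q_def[abs_def] by (intro pos_form_sum pos_form_rank_one)
  have ww: "w k p * cnj (w k q) = of_real (n k) * (a k (fst p) * b k (snd p) * cnj (a k (fst q)) * cnj (b k (snd q)))" for k p q
  proof -
    have "complex_of_real (sqrt (n k)) * of_real (sqrt (n k)) = of_real (n k)"
      by (simp only: of_real_mult[symmetric] real_sqrt_mult_self abs_of_nonneg[OF n])
    moreover have "w k p * cnj (w k q) = (complex_of_real (sqrt (n k)) * of_real (sqrt (n k)))
        * (a k (fst p) * b k (snd p) * cnj (a k (fst q)) * cnj (b k (snd q)))"
      unfolding w_def complex_cnj_mult complex_cnj_complex_of_real by (simp only: mult_ac)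
    ultimately show ?thesis by (simp only:)
  qed
  have trQ: "(\<Sum>p\<in>qubits. Q p p) = (\<Sum>k<2. of_real (n k))"
  proof -
    have "(\<Sum>p\<in>qubits. w k p * cnj (w k p)) = of_real (n k)" if "k < 2" for k
    proof (cases "n k = 0")
      case False
      have "(\<Sum>p\<in>qubits. w k p * cnj (w k p)) = of_real (n k) *
        (of_real ((cmod (a k 0))\<^sup>2 + (cmod (a k 1))\<^sup>2) * of_real ((cmod (b k 0))\<^sup>2 + (cmod (b k 1))\<^sup>2))"
        unfolding of_real_add cmod_power2_mult_cnj ww sum_qubits by (simp add: algebra_simps)
      then show ?thesis using a[OF that False] b[of k] by simp
    qed (simp add: ww)
    then show ?thesis unfolding Q_def by (subst sum.swap) simp
  qed
  have uu: "sform qubits (pt R) u u = - (\<Sum>k<2. of_real (n k))"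
  proof -
    have "of_real (n k) * cnj (c k) = of_real (n k)" if "k < 2" for k
      using arg_cong[OF c1[OF that], of cnj] by simp
    then have "(\<Sum>k<2. of_real (n k) * cnj (c k)) = (\<Sum>k<2. complex_of_real (n k))"
      by (intro sum.cong refl) (simp only: lessThan_iff)
    then show ?thesis by (simp only: WN uN)
  qed
  have QN: "(\<Sum>q\<in>qubits. pt Q p q * u q) = N p" if "p \<in> qubits" for p
  proof -
    define i j where "i = fst p" and "j = snd p"
    have p: "p = (i,j)" "i < 2" "j < 2" using that by (auto simp: i_def j_def)
    have "(\<Sum>q\<in>qubits. pt Q p q * u q) = (\<Sum>k<2. (of_real (n k) * c k) * a k i * cnj (b k j))"
      unfolding pt_def Q_def ww p(1) fst_conv snd_conv sum_qubits sum_lessThan_2 c_def v_def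
      by (simp only: ring_distribs mult_ac add_ac)
    also have "\<dots> = (\<Sum>k<2. of_real (n k) * a k i * cnj (b k j))" by (simp add: c1)
    finally show ?thesis by (simp add: p N)
  qed
  define P where "P p q = pt R p q + pt Q p q" for p q
  have Pu: "sform qubits P f u = 0" for f
  proof -
    have "(\<Sum>q\<in>qubits. P p q * u q) = 0" if "p \<in> qubits" for p
      using QN[OF that] by (simp add: P_def algebra_simps sum.distrib N_def)
    then show ?thesis by (simp add: sform_def mult.assoc flip: sum_distrib_left)
  qed
  have hermP: "P q p = cnj (P p q)" if "p \<in> qubits" "q \<in> qubits" for p q
  proof -
    have "pt Q q p = cnj (pt Q p q)" using that unfolding pt_def
      by (intro pos_form_hermitian[OF _ Q]) auto
    then show ?thesis using hermW[OF that] by (simp add: P_def)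
  qed
  have uP: "sform qubits P u f = 0" for f
  proof -
    have "sform qubits P u f = cnj (sform qubits P f u)" by (rule sform_hermitian) (rule hermP)
    then show ?thesis by (simp add: Pu)
  qed
  have P_pt: "P = pt (\<lambda>p q. R p q + Q p q)" by (auto simp: P_def pt_def fun_eq_iff)
  have "0 \<le> sform qubits P f f" for f
  proof (cases "u (0,0) * u (1,1) - u (0,1) * u (1,0) = 0")
    case False
    \<comment> \<open>The coefficients of det (f + z u) as a polynomial in z.\<close>
    let ?D = "u (0,0) * u (1,1) - u (0,1) * u (1,0)"
    let ?B = "f (0,0) * u (1,1) + u (0,0) * f (1,1) - f (0,1) * u (1,0) - u (0,1) * f (1,0)"
    let ?C = "f (0,0) * f (1,1) - f (0,1) * f (1,0)"
    obtain z where z: "?D * z\<^sup>2 + ?B * z * 1 + ?C * 1\<^sup>2 = 0"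
      using complex_quadratic_form_root[of ?D ?B ?C] False by metis
    define g where "g p = f p + z * u p" for p
    have "g (0,0) * g (1,1) = g (0,1) * g (1,0)"
      using z by (simp add: g_def power2_eq_square algebra_simps)
    then have "0 \<le> sform qubits P g g"
      unfolding P_pt by (intro pos_form_pt_det_zero pos_form_add R Q)
    also have "sform qubits P g g = sform qubits P f f"
      by (simp add: g_def[abs_def] sform_add_left sform_add_right sform_scale_left sform_scale_right Pu uP)
    finally show ?thesis .
  next
    case True
    \<comment> \<open>Here \<open>u\<close> is a product vector, so the minimum is nonnegative while
      equal to - (n 0 + n 1). All singular values vanish, \<open>Q\<close> is zero, and the minimum
      0 over contractions has to be spread to all vectors by scaling.\<close>
    then have "0 \<le> sform qubits (pt R) u u" by (intro pos_form_pt_det_zero R) simp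
    then have "n 0 + n 1 \<le> 0" by (simp add: uu less_eq_complex_def sum_lessThan_2)
    then have n0: "n k = 0" if "k < 2" for k
      using n[of 0] n[of 1] that by (auto simp: less_2_iff)
    have "pt Q p q = 0" for p q by (simp add: pt_def Q_def ww n0)
    then have P: "P = pt R" by (auto simp: P_def fun_eq_iff)
    obtain e :: real where e: "0 < e" "contraction2 (\<lambda>p. of_real e * f p)" by (rule contraction2_scale)
    have "0 \<le> Re (sform qubits (pt R) (\<lambda>p. of_real e * f p) (\<lambda>p. of_real e * f p))"
      using min[OF e(2)] by (simp add: uu n0)
    also have "\<dots> = e * e * Re (sform qubits (pt R) f f)"
      by (simp add: sform_scale_left sform_scale_right flip: of_real_mult)
    finally have "0 \<le> Re (sform qubits (pt R) f f)" using mult_pos_pos[OF e(1) e(1)]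
      by (metis zero_le_mult_iff not_less)
    moreover have "Im (sform qubits (pt R) f f) = 0"
      using arg_cong[OF sform_hermitian[of qubits "pt R" f f, OF hermW], of Im] by simp
    ultimately show ?thesis by (simp add: P less_eq_complex_def)
  qed
  then have "pos_form qubits P" by (simp add: pos_form_def)
  then show ?thesis
    by (intro that[of u Q]) (use u Q trQ uu in \<open>simp_all add: P_def[abs_def]\<close>)
qed

section \<open>Preservation of positive partial transposes\<close>

lemma psd_iff_pos_form:
  "psd n A \<longleftrightarrow> A \<in> carrier_mat n n \<and> pos_form {..<n} (\<lambda>i j. A $$ (i,j))"
proof (cases "A \<in> carrier_mat n n")
  case True
  have *: "(A *\<^sub>v v) \<bullet>c v = sform {..<n} (\<lambda>i j. A $$ (i,j)) (\<lambda>i. v $ i) (\<lambda>i. v $ i)"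
    if "v \<in> carrier_vec n" for v
    using that True
    by (simp add: scalar_prod_def sform_def sum_distrib_left sum_distrib_right lessThan_atLeast0 mult_ac)
  show ?thesis
  proof
    assume "psd n A"
    show "A \<in> carrier_mat n n \<and> pos_form {..<n} (\<lambda>i j. A $$ (i,j))"
      unfolding pos_form_def
    proof (intro conjI allI)
      fix f
      have "sform {..<n} (\<lambda>i j. A $$ (i,j)) f f
        = sform {..<n} (\<lambda>i j. A $$ (i,j)) (\<lambda>i. vec n f $ i) (\<lambda>i. vec n f $ i)"
        by (rule sform_cong) auto
      also have "0 \<le> \<dots>"
        unfolding *[OF vec_carrier, symmetric] using \<open>psd n A\<close> by (simp add: psd_def)
      finally show "0 \<le> sform {..<n} (\<lambda>i j. A $$ (i,j)) f f" .
    qed (fact True)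
  next
    assume "A \<in> carrier_mat n n \<and> pos_form {..<n} (\<lambda>i j. A $$ (i,j))"
    then show "psd n A" by (simp add: psd_def * pos_form_def)
  qed
qed (simp add: psd_def)

definition blk :: "nat \<Rightarrow> complex mat \<Rightarrow> nat \<times> nat \<Rightarrow> nat \<times> nat \<Rightarrow> complex" where
  "blk n X p q = X $$ (fst p * n + snd p, fst q * n + snd q)"

lemma pair_index_less: "a < k \<Longrightarrow> r < n \<Longrightarrow> a * n + r < k * (n::nat)"
proof -
  assume "a < k" "r < n"
  then have "a * n + r < Suc a * n" by simp
  also have "\<dots> \<le> k * n" using \<open>a < k\<close> by (intro mult_le_mono1) simp
  finally show ?thesis .
qed

lemma pair_index_bij: "bij_betw (\<lambda>p. fst p * n + snd p) ({..<k} \<times> {..<n}) {..<k * (n::nat)}"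
  by (rule bij_betw_byWitness[where f' = "\<lambda>i. (i div n, i mod n)"])
     (auto simp: pair_index_less less_mult_imp_div_less intro!: mod_less_divisor gr0I)

lemma psd_iff_blk:
  "psd (k * n) X \<longleftrightarrow> X \<in> carrier_mat (k * n) (k * n) \<and> pos_form ({..<k} \<times> {..<n}) (blk n X)"
  unfolding psd_iff_pos_form
  by (subst pos_form_reindex[OF pair_index_bij]) (simp add: blk_def[abs_def])

lemma blk_mat:
  assumes "p \<in> {..<k} \<times> {..<n}" "q \<in> {..<k} \<times> {..<n}"
  shows "blk n (mat (k * n) (k * n) f) p q = f (fst p * n + snd p, fst q * n + snd q)"
  using assms by (auto simp: blk_def pair_index_less)

lemma blk_ptranspose:
  assumes "p \<in> {..<m} \<times> {..<n}" "q \<in> {..<m} \<times> {..<n}"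
  shows "blk n (ptranspose m n X) p q = pt (blk n X) p q"
  unfolding ptranspose_def using assms by (subst blk_mat) (auto simp: blk_def pt_def)

lemma psd_ptranspose_iff:
  "psd (m * n) (ptranspose m n X) \<longleftrightarrow> pos_form ({..<m} \<times> {..<n}) (pt (blk n X))"
proof -
  have "pos_form ({..<m} \<times> {..<n}) (blk n (ptranspose m n X)) = pos_form ({..<m} \<times> {..<n}) (pt (blk n X))"
    by (rule pos_form_cong) (rule blk_ptranspose)
  then show ?thesis by (simp add: psd_iff_blk) (simp add: ptranspose_def)
qed

text \<open>The action of id (x) E on pair-indexed entries. \<open>id_tensor\<close> reduces to it
  directly and \<open>tensor_id\<close> after a swap of the factors, so both parties share one use
  of complete positivity.\<close>

definition lift_map :: "nat \<Rightarrow> superop \<Rightarrow> (nat \<times> nat \<Rightarrow> nat \<times> nat \<Rightarrow> complex) \<Rightarrow> nat \<times> nat \<Rightarrow> nat \<times> nat \<Rightarrow> complex" where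
  "lift_map n E W p q = E (mat n n (\<lambda>(r,s). W (fst p, r) (fst q, s))) $$ (snd p, snd q)"

lemma lift_map_cong:
  assumes "\<And>r s. r < n \<Longrightarrow> s < n \<Longrightarrow> W (fst p, r) (fst q, s) = V (fst p', r) (fst q', s)"
    and "snd p = snd p'" "snd q = snd q'"
  shows "lift_map n E W p q = lift_map n E V p' q'"
proof -
  have "mat n n (\<lambda>(r,s). W (fst p, r) (fst q, s)) = mat n n (\<lambda>(r,s). V (fst p', r) (fst q', s))"
    by (rule eq_matI) (use assms in auto)
  then show ?thesis by (simp add: lift_map_def assms)
qed

lemma blk_id_tensor:
  assumes "p \<in> {..<k} \<times> {..<m}" "q \<in> {..<k} \<times> {..<m}"
  shows "blk m (id_tensor k n m E X) p q = lift_map n E (blk n X) p q"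
  unfolding id_tensor_def using assms by (subst blk_mat) (auto simp: lift_map_def blk_def)

lemma blk_tensor_id:
  assumes "p \<in> {..<m} \<times> {..<k}" "q \<in> {..<m} \<times> {..<k}"
  shows "blk k (tensor_id n m k E X) p q
    = lift_map n E (\<lambda>p q. blk k X (prod.swap p) (prod.swap q)) (prod.swap p) (prod.swap q)"
  unfolding tensor_id_def using assms by (subst blk_mat) (auto simp: lift_map_def blk_def)

lemma cp_map_lift:
  assumes "cp_map n m E" "pos_form ({..<k} \<times> {..<n}) W"
  shows "pos_form ({..<k} \<times> {..<m}) (lift_map n E W)"
proof -
  define X where "X = mat (k * n) (k * n) (\<lambda>(i,j). W (i div n, i mod n) (j div n, j mod n))"
  have X: "blk n X p q = W p q" if "p \<in> {..<k} \<times> {..<n}" "q \<in> {..<k} \<times> {..<n}" for p q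
    unfolding X_def using that by (subst blk_mat) auto
  have "pos_form ({..<k} \<times> {..<n}) (blk n X)"
    using assms(2) by (subst pos_form_cong[OF X])
  then have "psd (k * n) X" by (simp add: psd_iff_blk) (simp add: X_def)
  then have "psd (k * m) (id_tensor k n m E X)" using assms(1) by (simp add: cp_map_def)
  then have "pos_form ({..<k} \<times> {..<m}) (blk m (id_tensor k n m E X))" by (simp add: psd_iff_blk)
  moreover have "blk m (id_tensor k n m E X) p q = lift_map n E W p q"
    if "p \<in> {..<k} \<times> {..<m}" "q \<in> {..<k} \<times> {..<m}" for p q
    unfolding blk_id_tensor[OF that] using that X by (intro lift_map_cong) auto
  ultimately show ?thesis by (subst (asm) pos_form_cong) auto
qed

lemma pos_form_swap:
  "pos_form (A \<times> B) W \<longleftrightarrow> pos_form (B \<times> A) (\<lambda>p q. W (prod.swap p) (prod.swap q))"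
  by (rule pos_form_reindex) (auto simp: bij_betw_def inj_on_def image_iff)

text \<open>The property shared by PPT-operations and protocols. The dimensions are parameters
  because it is propagated through intermediate systems of a protocol tree, and the argument is an
  unnormalized operator such as rho + Q.\<close>

definition ppt_preserving :: "nat \<Rightarrow> nat \<Rightarrow> nat \<Rightarrow> nat \<Rightarrow> superop \<Rightarrow> bool" where
  "ppt_preserving a b a' b' \<Lambda> \<longleftrightarrow>
     (\<forall>X \<in> carrier_mat (a * b) (a * b). psd (a * b) (ptranspose a b X) \<longrightarrow> psd (a' * b') (ptranspose a' b' (\<Lambda> X)))"

text \<open>Transposition on Bob's side only permutes the blocks on which Alice's map acts, so the
  two commute.\<close>

lemma ppt_preserving_tensor_id:
  assumes "cp_map a m E"
  shows "ppt_preserving a b m b (tensor_id a m b E)"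
  unfolding ppt_preserving_def psd_ptranspose_iff
proof (intro ballI impI)
  fix X assume "pos_form ({..<a} \<times> {..<b}) (pt (blk b X))"
  then have "pos_form ({..<b} \<times> {..<a}) (\<lambda>p q. pt (blk b X) (prod.swap p) (prod.swap q))"
    by (subst (asm) pos_form_swap)
  from cp_map_lift[OF assms this]
  have "pos_form ({..<m} \<times> {..<b}) (\<lambda>p q. lift_map a E (\<lambda>p q. pt (blk b X) (prod.swap p) (prod.swap q)) (prod.swap p) (prod.swap q))"
    by (subst (asm) pos_form_swap)
  moreover have "lift_map a E (\<lambda>p q. pt (blk b X) (prod.swap p) (prod.swap q)) (prod.swap p) (prod.swap q)
      = pt (blk b (tensor_id a m b E X)) p q" if "p \<in> {..<m} \<times> {..<b}" "q \<in> {..<m} \<times> {..<b}" for p q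
    unfolding pt_def using that by (subst blk_tensor_id) (auto intro!: lift_map_cong)
  ultimately show "pos_form ({..<m} \<times> {..<b}) (pt (blk b (tensor_id a m b E X)))"
    by (subst (asm) pos_form_cong) auto
qed

text \<open>Bob's map need not commute with transposition on his own side. A full transpose, which
  keeps positivity, turns it into transposition on Alice's side, which does commute; a second full
  transpose turns it back.\<close>

lemma ppt_preserving_id_tensor:
  assumes "cp_map b m E"
  shows "ppt_preserving a b a m (id_tensor a b m E)"
  unfolding ppt_preserving_def psd_ptranspose_iff
proof (intro ballI impI)
  fix X assume "pos_form ({..<a} \<times> {..<b}) (pt (blk b X))"
  from cp_map_lift[OF assms pos_form_transpose[OF this]]
  have "pos_form ({..<a} \<times> {..<m}) (\<lambda>p q. lift_map b E (\<lambda>i j. pt (blk b X) j i) q p)"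
    by (rule pos_form_transpose)
  moreover have "lift_map b E (\<lambda>i j. pt (blk b X) j i) q p
      = pt (blk m (id_tensor a b m E X)) p q" if "p \<in> {..<a} \<times> {..<m}" "q \<in> {..<a} \<times> {..<m}" for p q
    unfolding pt_def using that by (subst blk_id_tensor) (auto intro!: lift_map_cong)
  ultimately show "pos_form ({..<a} \<times> {..<m}) (pt (blk m (id_tensor a b m E X)))"
    by (subst (asm) pos_form_cong) auto
qed

lemma ppt_preserving_mat_sum:
  assumes "\<And>x. x < N \<Longrightarrow> psd (a * b) (ptranspose a b (F x))"
  shows "psd (a * b) (ptranspose a b (mat_sum (a * b) N F))"
proof -
  have "pos_form ({..<a} \<times> {..<b}) (\<lambda>p q. \<Sum>x<N. pt (blk b (F x)) p q)"
    using assms unfolding psd_ptranspose_iff by (intro pos_form_sum) simp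
  moreover have "pt (blk b (mat_sum (a * b) N F)) p q = (\<Sum>x<N. pt (blk b (F x)) p q)"
    if "p \<in> {..<a} \<times> {..<b}" "q \<in> {..<a} \<times> {..<b}" for p q
    using that by (auto simp: pt_def mat_sum_def blk_def pair_index_less)
  ultimately show ?thesis
    unfolding psd_ptranspose_iff by (subst pos_form_cong) auto
qed

lemma locc_ppt_preserving: "locc a' b' a b \<Lambda> \<Longrightarrow> ppt_preserving a b a' b' \<Lambda>"
proof (induction rule: locc.induct)
  case locc_done
  show ?case by (simp add: ppt_preserving_def)
next
  case (locc_Alice a N m E b \<Lambda>)
  show ?case
    unfolding ppt_preserving_def
  proof (intro ballI impI ppt_preserving_mat_sum)
    fix X x
    assume X: "X \<in> carrier_mat (a * b) (a * b)" "psd (a * b) (ptranspose a b X)" and x: "x < N"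
    then have "psd (m x * b) (ptranspose (m x) b (tensor_id a (m x) b (E x) X))"
      using ppt_preserving_tensor_id[of a "m x" "E x" b] locc_Alice(1)
      by (simp add: ppt_preserving_def instrument_def)
    moreover have "tensor_id a (m x) b (E x) X \<in> carrier_mat (m x * b) (m x * b)"
      by (simp add: tensor_id_def)
    ultimately show "psd (a' * b') (ptranspose a' b' (\<Lambda> x (tensor_id a (m x) b (E x) X)))"
      using locc_Alice(2) x by (simp add: ppt_preserving_def)
  qed
next
  case (locc_Bob b N m E a \<Lambda>)
  show ?case
    unfolding ppt_preserving_def
  proof (intro ballI impI ppt_preserving_mat_sum)
    fix X x
    assume X: "X \<in> carrier_mat (a * b) (a * b)" "psd (a * b) (ptranspose a b X)" and x: "x < N"
    then have "psd (a * m x) (ptranspose a (m x) (id_tensor a b (m x) (E x) X))"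
      using ppt_preserving_id_tensor[of b "m x" "E x" a] locc_Bob(1)
      by (simp add: ppt_preserving_def instrument_def)
    moreover have "id_tensor a b (m x) (E x) X \<in> carrier_mat (a * m x) (a * m x)"
      by (simp add: id_tensor_def)
    ultimately show "psd (a' * b') (ptranspose a' b' (\<Lambda> x (id_tensor a b (m x) (E x) X)))"
      using locc_Bob(2) x by (simp add: ppt_preserving_def)
  qed
qed

section \<open>The upper bound\<close>

lemma pos_form_contract:
  assumes "finite I" "pos_form (I \<times> J) M" "pos_form I S"
  shows "pos_form J (\<lambda>p q. \<Sum>x\<in>I. \<Sum>y\<in>I. M (x,p) (y,q) * S y x)"
proof -
  \<comment> \<open>The form in question is the partial trace over \<open>I\<close> of M (S (x) 1).
    Splitting \<open>S\<close> into rank one forms makes it a sum of compressions of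
    \<open>M\<close> by vectors of the first factor.\<close>
  obtain w where w: "\<forall>x\<in>I. \<forall>y\<in>I. S x y = (\<Sum>t\<in>I. w t x * cnj (w t y))"
    using pos_form_decomp[OF assms(1,3)] by blast
  have *: "(\<Sum>x\<in>I. \<Sum>y\<in>I. M (x,p) (y,q) * S y x)
     = (\<Sum>t\<in>I. \<Sum>x\<in>I. \<Sum>y\<in>I. cnj (w t x) * M (x,p) (y,q) * w t y)" for p q
  proof -
    have "(\<Sum>x\<in>I. \<Sum>y\<in>I. M (x,p) (y,q) * S y x)
       = (\<Sum>x\<in>I. \<Sum>y\<in>I. \<Sum>t\<in>I. cnj (w t x) * M (x,p) (y,q) * w t y)"
      using w by (intro sum.cong refl) (simp add: sum_distrib_left mult_ac)
    also have "\<dots> = (\<Sum>x\<in>I. \<Sum>t\<in>I. \<Sum>y\<in>I. cnj (w t x) * M (x,p) (y,q) * w t y)"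
      by (intro sum.cong refl sum.swap)
    also have "\<dots> = (\<Sum>t\<in>I. \<Sum>x\<in>I. \<Sum>y\<in>I. cnj (w t x) * M (x,p) (y,q) * w t y)"
      by (rule sum.swap)
    finally show ?thesis .
  qed
  have c: "pos_form J (\<lambda>p q. \<Sum>x\<in>I. \<Sum>y\<in>I. cnj (v x) * M (x,p) (y,q) * v y)" for v
    unfolding pos_form_def
  proof
    fix f
    have "sform J (\<lambda>p q. \<Sum>x\<in>I. \<Sum>y\<in>I. cnj (v x) * M (x,p) (y,q) * v y) f f
      = (\<Sum>p\<in>J. \<Sum>q\<in>J. \<Sum>x\<in>I. \<Sum>y\<in>I. cnj (v x * f p) * M (x,p) (y,q) * (v y * f q))"
      by (simp add: sform_def sum_distrib_left sum_distrib_right mult_ac)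
    also have "\<dots> = (\<Sum>p\<in>J. \<Sum>x\<in>I. \<Sum>q\<in>J. \<Sum>y\<in>I. cnj (v x * f p) * M (x,p) (y,q) * (v y * f q))"
      by (intro sum.cong refl sum.swap)
    also have "\<dots> = (\<Sum>x\<in>I. \<Sum>p\<in>J. \<Sum>q\<in>J. \<Sum>y\<in>I. cnj (v x * f p) * M (x,p) (y,q) * (v y * f q))"
      by (rule sum.swap)
    also have "\<dots> = (\<Sum>x\<in>I. \<Sum>p\<in>J. \<Sum>y\<in>I. \<Sum>q\<in>J. cnj (v x * f p) * M (x,p) (y,q) * (v y * f q))"
      by (intro sum.cong refl sum.swap)
    also have "\<dots> = sform (I \<times> J) M (\<lambda>z. v (fst z) * f (snd z)) (\<lambda>z. v (fst z) * f (snd z))"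
      by (simp add: sform_def sum.cartesian_product')
    also have "0 \<le> \<dots>" using assms(2) by (simp add: pos_form_def)
    finally show "0 \<le> sform J (\<lambda>p q. \<Sum>x\<in>I. \<Sum>y\<in>I. cnj (v x) * M (x,p) (y,q) * v y) f f" .
  qed
  show ?thesis unfolding * by (rule pos_form_sum) (rule c)
qed

text \<open>Regroups the order A, A', B, B' as ((A, B), (A', B')), so that the trace over AB becomes
  a contraction of the first component.\<close>

definition idx4p :: "(nat \<times> nat) \<times> (nat \<times> nat) \<Rightarrow> nat" where
  "idx4p z = idx4 (fst (fst z)) (fst (snd z)) (snd (fst z)) (snd (snd z))"

lemma binary_digits_16: "8 * (i div 8) + 4 * (i div 4 mod 2) + 2 * (i div 2 mod 2) + i mod 2 = (i::nat)"
proof -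
  have "i div 2 div 2 = i div 4" "i div 4 div 2 = i div 8" by (simp_all add: div_mult2_eq[symmetric])
  then show ?thesis
    using mult_div_mod_eq[of 2 i] mult_div_mod_eq[of 2 "i div 2"] mult_div_mod_eq[of 2 "i div 4"] by linarith
qed

lemma idx4p_bij: "bij_betw idx4p (qubits \<times> qubits) {..<16}"
  by (rule bij_betw_byWitness[where f' = "\<lambda>i. ((i div 8, (i div 2) mod 2), ((i div 4) mod 2, i mod 2))"])
     (auto simp: idx4p_def idx4_def less_2_iff binary_digits_16)

lemma sum_idx4p: "(\<Sum>i<16. f i) = (\<Sum>x\<in>qubits. \<Sum>p\<in>qubits. f (idx4p (x,p)))"
  unfolding sum.reindex_bij_betw[OF idx4p_bij, symmetric] by (simp add: sum.cartesian_product')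

lemma idx4p_less: "z \<in> qubits \<times> qubits \<Longrightarrow> idx4p z < 16"
  using idx4p_bij by (auto simp: bij_betw_def)

lemma AB_part_idx4p: "x \<in> qubits \<Longrightarrow> p \<in> qubits \<Longrightarrow> AB_part (idx4p (x,p)) = fst x * 2 + snd x"
  by (auto simp: AB_part_def idx4p_def idx4_def less_2_iff)

lemma A'B'_part_idx4p: "x \<in> qubits \<Longrightarrow> p \<in> qubits \<Longrightarrow> A'B'_part (idx4p (x,p)) = fst p * 2 + snd p"
  by (auto simp: A'B'_part_def idx4p_def idx4_def less_2_iff)

lemma pair_index_2_less: "p \<in> qubits \<Longrightarrow> fst p * 2 + snd p < 4"
  by auto

lemma pair_index_2_eq: "p \<in> qubits \<Longrightarrow> q \<in> qubits \<Longrightarrow> fst p * 2 + snd p = fst q * 2 + snd q \<longleftrightarrow> p = q"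
  by (auto simp: less_2_iff)

lemma ptrace_AB_tensor:
  assumes "R \<in> carrier_mat 16 16" "X \<in> carrier_mat 4 4" "p \<in> qubits" "q \<in> qubits"
  shows "blk 2 (ptrace_AB (R * tensor_I_A'B' X)) p q
    = (\<Sum>x\<in>qubits. \<Sum>y\<in>qubits. R $$ (idx4p (x,p), idx4p (y,q)) * blk 2 X y x)"
proof -
  have "blk 2 (ptrace_AB (R * tensor_I_A'B' X)) p q
    = (\<Sum>x\<in>qubits. (R * tensor_I_A'B' X) $$ (idx4p (x,p), idx4p (x,q)))"
    using assms(3,4) pair_index_2_less[OF assms(3)] pair_index_2_less[OF assms(4)]
    by (auto simp: blk_def ptrace_AB_def idx4p_def sum_qubits sum_lessThan_2 add.assoc)
  also have "\<dots> = (\<Sum>x\<in>qubits. \<Sum>y\<in>qubits. R $$ (idx4p (x,p), idx4p (y,q)) * blk 2 X y x)"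
  proof (intro sum.cong refl)
    fix x assume x: "x \<in> qubits"
    have "(R * tensor_I_A'B' X) $$ (idx4p (x,p), idx4p (x,q))
      = (\<Sum>i<16. R $$ (idx4p (x,p), i) * tensor_I_A'B' X $$ (i, idx4p (x,q)))"
      using assms(1) idx4p_less[of "(x,p)"] idx4p_less[of "(x,q)"] x assms(3,4)
      by (simp add: scalar_prod_def tensor_I_A'B'_def lessThan_atLeast0)
    also have "\<dots> = (\<Sum>y\<in>qubits. \<Sum>r\<in>qubits. R $$ (idx4p (x,p), idx4p (y,r)) * tensor_I_A'B' X $$ (idx4p (y,r), idx4p (x,q)))"
      by (rule sum_idx4p)
    also have "\<dots> = (\<Sum>y\<in>qubits. \<Sum>r\<in>qubits. if r = q then R $$ (idx4p (x,p), idx4p (y,q)) * blk 2 X y x else 0)"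
    proof (intro sum.cong refl)
      fix y r assume "y \<in> qubits" "r \<in> qubits"
      then show "R $$ (idx4p (x,p), idx4p (y,r)) * tensor_I_A'B' X $$ (idx4p (y,r), idx4p (x,q))
         = (if r = q then R $$ (idx4p (x,p), idx4p (y,q)) * blk 2 X y x else 0)"
        using x assms(4) idx4p_less[of "(y,r)"] idx4p_less[of "(x,q)"]
        by (simp add: tensor_I_A'B'_def AB_part_idx4p A'B'_part_idx4p blk_def pair_index_2_eq)
    qed
    also have "\<dots> = (\<Sum>y\<in>qubits. R $$ (idx4p (x,p), idx4p (y,q)) * blk 2 X y x)"
      using assms(4) by (intro sum.cong refl) (simp add: sum.delta)
    finally show "(R * tensor_I_A'B' X) $$ (idx4p (x,p), idx4p (x,q))
       = (\<Sum>y\<in>qubits. R $$ (idx4p (x,p), idx4p (y,q)) * blk 2 X y x)" .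
  qed
  finally show ?thesis .
qed

lemma idx4_div_mod_4:
  assumes "b < 2" "b' < 2"
  shows "idx4 a a' b b' div 4 = 2 * a + a'" "idx4 a a' b b' mod 4 = 2 * b + b'"
proof -
  have "idx4 a a' b b' = (2 * b + b') + (2 * a + a') * 4" "2 * b + b' < 4" using assms by (simp_all add: idx4_def)
  then show "idx4 a a' b b' div 4 = 2 * a + a'" "idx4 a a' b b' mod 4 = 2 * b + b'"
    by (simp_all only: div_mult_self1 mod_mult_self1 div_less mod_less)
qed

lemma ptranspose_idx4:
  assumes "a < 2" "a' < 2" "b < 2" "b' < 2" "c < 2" "c' < 2" "d < 2" "d' < 2"
  shows "ptranspose 4 4 R $$ (idx4 a a' b b', idx4 c c' d d') = R $$ (idx4 a a' d d', idx4 c c' b b')"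
proof -
  have "idx4 a a' b b' < 16" "idx4 c c' d d' < 16" using assms by (simp_all add: idx4_def)
  then have "ptranspose 4 4 R $$ (idx4 a a' b b', idx4 c c' d d')
    = R $$ ((2 * a + a') * 4 + (2 * d + d'), (2 * c + c') * 4 + (2 * b + b'))"
    using assms by (simp add: ptranspose_def idx4_div_mod_4)
  moreover have "(2 * a + a') * 4 + (2 * d + d') = idx4 a a' d d'" "(2 * c + c') * 4 + (2 * b + b') = idx4 c c' b b'"
    by (simp_all add: idx4_def)
  ultimately show ?thesis by (simp only:)
qed

text \<open>The trace over AB of a product is unchanged when both factors are transposed on B. With
  \<open>R\<close> transposed on B and B', what remains is a transposition on B', that is, the
  partial transpose of the output; positivity then follows by contraction.\<close>

lemma ppt_operation_ppt_preserving:
  assumes "ppt_operation \<Lambda>"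
  shows "ppt_preserving 2 2 2 2 \<Lambda>"
  unfolding ppt_preserving_def psd_ptranspose_iff
proof (intro ballI impI)
  fix X :: "complex mat"
  assume "X \<in> carrier_mat (2 * 2) (2 * 2)" and pos: "pos_form qubits (pt (blk 2 X))"
  then have X: "X \<in> carrier_mat 4 4" by simp
  obtain R where R: "dual_state \<Lambda> R" and Rpt: "psd 16 (ptranspose 4 4 R)"
    using assms by (auto simp: ppt_operation_def)
  have Rc: "R \<in> carrier_mat 16 16" using R by (simp add: dual_state_def psd_def)
  define M where "M z z' = ptranspose 4 4 R $$ (idx4p z, idx4p z')" for z z'
  have M: "pos_form (qubits \<times> qubits) M"
    using Rpt unfolding psd_iff_pos_form pos_form_reindex[OF idx4p_bij] M_def[abs_def] by simp
  have "pos_form qubits (\<lambda>p q. 4 * (\<Sum>x\<in>qubits. \<Sum>y\<in>qubits. M (x,q) (y,p) * pt (blk 2 X) y x))"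
  proof -
    have S: "pos_form qubits (\<lambda>p q. \<Sum>x\<in>qubits. \<Sum>y\<in>qubits. M (x,q) (y,p) * pt (blk 2 X) y x)" (is "pos_form _ ?S")
      by (rule pos_form_transpose, rule pos_form_contract[OF _ M pos]) simp
    have "pos_form qubits (\<lambda>p q. \<Sum>k\<in>{..<4::nat}. ?S p q)" by (rule pos_form_sum) (rule S)
    then show ?thesis by (simp only: sum_constant card_lessThan of_nat_numeral)
  qed
  moreover have "4 * (\<Sum>x\<in>qubits. \<Sum>y\<in>qubits. M (x,q) (y,p) * pt (blk 2 X) y x) = pt (blk 2 (\<Lambda> X)) p q"
    if p: "p \<in> qubits" and q: "q \<in> qubits" for p q
  proof -
    define p' q' where "p' = (fst p, snd q)" and "q' = (fst q, snd p)"
    have pq': "p' \<in> qubits" "q' \<in> qubits" using p q by (auto simp: p'_def q'_def)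
    have T: "transpose_mat (\<Lambda> X) = 4 \<cdot>\<^sub>m ptrace_AB (R * tensor_I_A'B' X)"
      using R X by (simp add: dual_state_def)
    have dim: "dim_row (\<Lambda> X) = 4" "dim_col (\<Lambda> X) = 4"
      using arg_cong[OF T, of dim_row] arg_cong[OF T, of dim_col] by (simp_all add: ptrace_AB_def)
    have "pt (blk 2 (\<Lambda> X)) p q = blk 2 (transpose_mat (\<Lambda> X)) q' p'"
      using pair_index_2_less[OF pq'(1)] pair_index_2_less[OF pq'(2)] dim
      by (simp add: pt_def blk_def p'_def q'_def)
    also have "\<dots> = 4 * blk 2 (ptrace_AB (R * tensor_I_A'B' X)) q' p'"
      using pair_index_2_less[OF pq'(1)] pair_index_2_less[OF pq'(2)]
      by (simp add: T blk_def ptrace_AB_def)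
    also have "\<dots> = 4 * (\<Sum>x\<in>qubits. \<Sum>y\<in>qubits. R $$ (idx4p (x,q'), idx4p (y,p')) * blk 2 X y x)"
      by (simp only: ptrace_AB_tensor[OF Rc X pq'(2,1)])
    also have "(\<Sum>x\<in>qubits. \<Sum>y\<in>qubits. R $$ (idx4p (x,q'), idx4p (y,p')) * blk 2 X y x)
      = (\<Sum>x\<in>qubits. \<Sum>y\<in>qubits. M (x,q) (y,p) * pt (blk 2 X) y x)"
      unfolding M_def idx4p_def sum_qubits fst_conv snd_conv p'_def q'_def pt_def using p q
      by (simp add: ptranspose_idx4 mem_Times_iff)
    finally show ?thesis by simp
  qed
  ultimately show "pos_form qubits (pt (blk 2 (\<Lambda> X)))"
    by (subst (asm) pos_form_cong) auto
qed

section \<open>Maximally entangled vectors and their overlap with PPT operators\<close>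

lemma pt_orthonormal_rows:
  assumes "\<And>i k. i < 2 \<Longrightarrow> k < 2 \<Longrightarrow> (\<Sum>j<2. cnj (m (i,j)) * m (k,j)) = (if i = k then 1 else 0)"
  shows "sform qubits (pt T) (\<lambda>p. if snd p = 0 then - m (fst p, 1) else m (fst p, 0))
      (\<lambda>p. if snd p = 0 then - m (fst p, 1) else m (fst p, 0)) + sform qubits T m m = (\<Sum>p\<in>qubits. T p p)"
proof -
  \<comment> \<open>For \<open>m\<close> the identity matrix, the partial transpose of the
    unnormalized Bell projection is the swap, and 1 - swap is the projection on
    \<open>?\<phi>\<close> = |01> - |10>, up to the factor 2. A unitary on the first factor carries
    this to general \<open>m\<close>.\<close>
  let ?\<phi> = "\<lambda>p. if snd p = 0 then - m (fst p, 1) else m (fst p, 0)"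
  have "sform qubits (pt T) ?\<phi> ?\<phi> + sform qubits T m m
     = (\<Sum>i<2. \<Sum>k<2. \<Sum>j<2. T (i,j) (k,j) * (\<Sum>l<2. cnj (m (i,l)) * m (k,l)))"
    by (simp add: sform_def sum_qubits sum_lessThan_2 pt_def algebra_simps)
  also have "\<dots> = (\<Sum>p\<in>qubits. T p p)"
    using assms by (simp add: sum_lessThan_2 sum_qubits)
  finally show ?thesis .
qed

lemma mult_vec_cscalar_blk:
  assumes "\<tau> \<in> carrier_mat 4 4" "v \<in> carrier_vec 4"
  shows "(\<tau> *\<^sub>v v) \<bullet>c v = sform qubits (blk 2 \<tau>) (\<lambda>p. v $ (fst p * 2 + snd p)) (\<lambda>p. v $ (fst p * 2 + snd p))"
proof -
  have "(\<tau> *\<^sub>v v) \<bullet>c v = sform {..<2 * 2} (\<lambda>i j. \<tau> $$ (i,j)) (\<lambda>i. v $ i) (\<lambda>i. v $ i)"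
    using assms by (simp add: scalar_prod_def sform_def sum_distrib_left sum_distrib_right lessThan_atLeast0 mult_ac)
  then show ?thesis
    by (simp only: sform_reindex[OF pair_index_bij, where A = "\<lambda>i j. \<tau> $$ (i,j)" and f = "\<lambda>i. v $ i" and g = "\<lambda>i. v $ i", symmetric] blk_def[abs_def])
qed

lemma mat_trace_blk:
  assumes "\<tau> \<in> carrier_mat 4 4"
  shows "mat_trace \<tau> = (\<Sum>p\<in>qubits. blk 2 \<tau> p p)"
proof -
  have "mat_trace \<tau> = (\<Sum>i<2 * 2. \<tau> $$ (i,i))" using assms by (simp add: mat_trace_def)
  also have "\<dots> = (\<Sum>p\<in>qubits. \<tau> $$ (fst p * 2 + snd p, fst p * 2 + snd p))"
    by (rule sum.reindex_bij_betw[OF pair_index_bij, symmetric])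
  finally show ?thesis by (simp add: blk_def)
qed


lemma unitary_mat_2:
  assumes "unitary_mat 2 U"
  shows "i < 2 \<Longrightarrow> j < 2 \<Longrightarrow> (\<Sum>k<2. cnj (U $$ (k,i)) * U $$ (k,j)) = (if i = j then 1 else 0)"
    and "i < 2 \<Longrightarrow> j < 2 \<Longrightarrow> (\<Sum>k<2. U $$ (i,k) * cnj (U $$ (j,k))) = (if i = j then 1 else 0)"
proof -
  have U: "U \<in> carrier_mat 2 2" "mat_adjoint U * U = 1\<^sub>m 2" using assms by (auto simp: unitary_mat_def)
  have A: "mat_adjoint U \<in> carrier_mat 2 2" using U by (auto simp: mat_adjoint_def)
  have entry: "mat_adjoint U $$ (i,j) = cnj (U $$ (j,i))" if "i < 2" "j < 2" for i j
    using that U(1) by (simp add: mat_adjoint_def mat_of_rows_def)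
  have "U * mat_adjoint U = 1\<^sub>m 2" by (rule mat_mult_left_right_inverse[OF A U])
  then have "(U * mat_adjoint U) $$ (i,j) = 1\<^sub>m 2 $$ (i,j)" by simp
  moreover have "(mat_adjoint U * U) $$ (i,j) = 1\<^sub>m 2 $$ (i,j)" using U by simp
  ultimately show "i < 2 \<Longrightarrow> j < 2 \<Longrightarrow> (\<Sum>k<2. cnj (U $$ (k,i)) * U $$ (k,j)) = (if i = j then 1 else 0)"
    "i < 2 \<Longrightarrow> j < 2 \<Longrightarrow> (\<Sum>k<2. U $$ (i,k) * cnj (U $$ (j,k))) = (if i = j then 1 else 0)"
    using U(1) A by (simp_all add: scalar_prod_def entry lessThan_atLeast0[symmetric])
qed

text \<open>The coefficient matrix of U (x) V applied to the Bell vector is U times the transpose of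
  V, over sqrt 2; here \<open>m\<close> is that unitary product.\<close>

lemma max_entangled_coeffs:
  assumes "\<psi> \<in> max_entangled"
  obtains m where "\<psi> \<in> carrier_vec 4"
    "\<And>p. p \<in> qubits \<Longrightarrow> \<psi> $ (fst p * 2 + snd p) = of_real (1 / sqrt 2) * m p"
    "\<And>i k. i < 2 \<Longrightarrow> k < 2 \<Longrightarrow> (\<Sum>j<2. cnj (m (i,j)) * m (k,j)) = (if i = k then 1 else 0)"
proof -
  obtain U V where \<psi>: "\<psi> = kron U V *\<^sub>v bell_vec" and U: "unitary_mat 2 U" and V: "unitary_mat 2 V"
    using assms by (auto simp: max_entangled_def)
  have Uc: "U \<in> carrier_mat 2 2" "V \<in> carrier_mat 2 2" using U V by (auto simp: unitary_mat_def)
  define m where "m p = (\<Sum>a<2. U $$ (fst p, a) * V $$ (snd p, a))" for p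
  show ?thesis
  proof (rule that[of m])
    show "\<psi> \<in> carrier_vec 4" using Uc by (simp add: \<psi> kron_def carrier_vecI)
    show "\<psi> $ (fst p * 2 + snd p) = of_real (1 / sqrt 2) * m p" if "p \<in> qubits" for p
    proof -
      have lt: "fst p * 2 + snd p < 4" by (rule pair_index_2_less[OF that])
      have dm: "(fst p * 2 + snd p) div 2 = fst p" "(fst p * 2 + snd p) mod 2 = snd p" using that by auto
      have "\<psi> $ (fst p * 2 + snd p) = (\<Sum>i<4. kron U V $$ (fst p * 2 + snd p, i) * bell_vec $ i)"
        using Uc lt unfolding \<psi> by (simp add: scalar_prod_def kron_def bell_vec_def lessThan_atLeast0)
      also have "\<dots> = (\<Sum>i<4. U $$ (fst p, i div 2) * V $$ (snd p, i mod 2) * bell_vec $ i)"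
        using Uc lt dm by (intro sum.cong refl) (simp add: kron_def)
      also have "{..<4} = {0,1,2,3::nat}" by auto
      also have "(\<Sum>i\<in>{0,1,2,3::nat}. U $$ (fst p, i div 2) * V $$ (snd p, i mod 2) * bell_vec $ i)
        = of_real (1 / sqrt 2) * m p"
        by (simp add: bell_vec_def m_def sum_lessThan_2 algebra_simps)
      finally show ?thesis .
    qed
    show "(\<Sum>j<2. cnj (m (i,j)) * m (k,j)) = (if i = k then 1 else 0)" if "i < 2" "k < 2" for i k
    proof -
      have "(\<Sum>j<2. cnj (m (i,j)) * m (k,j))
        = (\<Sum>a<2. \<Sum>b<2. U $$ (k,b) * cnj (U $$ (i,a)) * (\<Sum>j<2. cnj (V $$ (j,a)) * V $$ (j,b)))"
        by (simp add: m_def sum_lessThan_2 algebra_simps)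
      also have "\<dots> = (\<Sum>a<2. U $$ (k,a) * cnj (U $$ (i,a)))"
        using unitary_mat_2(1)[OF V] by (simp add: sum_lessThan_2)
      also have "\<dots> = (if i = k then 1 else 0)" using unitary_mat_2(2)[OF U that(2,1)] by auto
      finally show ?thesis .
    qed
  qed
qed

text \<open>A maximally entangled projection has partial transpose at most \<open>1/2\<close>: the gap is again a projection.\<close>

lemma max_entangled_ppt_bound:
  assumes \<tau>: "\<tau> \<in> carrier_mat 4 4" and ppt: "pos_form qubits (pt (blk 2 \<tau>))" and \<psi>: "\<psi> \<in> max_entangled"
  shows "Re ((\<tau> *\<^sub>v \<psi>) \<bullet>c \<psi>) \<le> Re (mat_trace \<tau>) / 2"
proof -
  obtain m where m: "\<psi> \<in> carrier_vec 4"
    "\<And>p. p \<in> qubits \<Longrightarrow> \<psi> $ (fst p * 2 + snd p) = of_real (1 / sqrt 2) * m p"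
    "\<And>i k. i < 2 \<Longrightarrow> k < 2 \<Longrightarrow> (\<Sum>j<2. cnj (m (i,j)) * m (k,j)) = (if i = k then 1 else 0)"
    using max_entangled_coeffs[OF \<psi>] by blast
  have "(\<tau> *\<^sub>v \<psi>) \<bullet>c \<psi> = sform qubits (blk 2 \<tau>) (\<lambda>p. of_real (1 / sqrt 2) * m p) (\<lambda>p. of_real (1 / sqrt 2) * m p)"
    unfolding mult_vec_cscalar_blk[OF \<tau> m(1)] by (rule sform_cong) (simp_all only: m(2))
  also have "\<dots> = of_real (1 / sqrt 2 * (1 / sqrt 2)) * sform qubits (blk 2 \<tau>) m m"
    by (simp only: sform_scale_left sform_scale_right of_real_mult complex_cnj_complex_of_real mult.assoc)
  finally have "(\<tau> *\<^sub>v \<psi>) \<bullet>c \<psi> * 2 = sform qubits (blk 2 \<tau>) m m" by simp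
  from arg_cong[OF this, of Re]
  have e: "2 * Re ((\<tau> *\<^sub>v \<psi>) \<bullet>c \<psi>) = Re (sform qubits (blk 2 \<tau>) m m)" by simp
  let ?\<phi> = "\<lambda>p. if snd p = 0 then - m (fst p, 1) else m (fst p, 0)"
  have "sform qubits (pt (blk 2 \<tau>)) ?\<phi> ?\<phi> + sform qubits (blk 2 \<tau>) m m = mat_trace \<tau>"
    unfolding mat_trace_blk[OF \<tau>] by (rule pt_orthonormal_rows) (rule m(3))
  moreover have "0 \<le> sform qubits (pt (blk 2 \<tau>)) ?\<phi> ?\<phi>" using ppt by (simp add: pos_form_def)
  ultimately show ?thesis using e by (auto simp: less_eq_complex_def complex_eq_iff)
qed

lemma bell_vec_max_entangled: "bell_vec \<in> max_entangled"
proof -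
  have "unitary_mat 2 (1\<^sub>m 2)"
    by (auto simp: unitary_mat_def mat_adjoint_def mat_of_rows_def scalar_prod_def lessThan_atLeast0[symmetric]
      sum_lessThan_2 less_2_iff intro!: eq_matI)
  moreover have "kron (1\<^sub>m 2) (1\<^sub>m 2) = 1\<^sub>m 4"
  proof (rule eq_matI)
    fix i j assume "i < dim_row (1\<^sub>m 4)" "j < dim_col (1\<^sub>m 4)"
    then show "kron (1\<^sub>m 2) (1\<^sub>m 2) $$ (i,j) = 1\<^sub>m 4 $$ (i,j)"
      by (simp add: kron_def less_mult_imp_div_less) (metis div_mult_mod_eq)
  qed (simp_all add: kron_def)
  moreover have "bell_vec \<in> carrier_vec 4" by (simp add: bell_vec_def)
  ultimately show ?thesis unfolding max_entangled_def
    by (intro CollectI exI[of _ "1\<^sub>m 2"]) simp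
qed

lemma fidelity_candidates_le:
  assumes \<rho>: "density_op 4 \<rho>" and \<Lambda>: "cptp_map 4 4 \<Lambda>" "ppt_preserving 2 2 2 2 \<Lambda>"
    and Q: "pos_form qubits Q" "pos_form qubits (\<lambda>p q. pt (blk 2 \<rho>) p q + pt Q p q)"
    and \<psi>: "\<psi> \<in> max_entangled"
  shows "Re ((\<Lambda> \<rho> *\<^sub>v \<psi>) \<bullet>c \<psi>) \<le> (1 + Re (\<Sum>p\<in>qubits. Q p p)) / 2"
proof -
  define K where "K = mat 4 4 (\<lambda>(i,j). Q (i div 2, i mod 2) (j div 2, j mod 2))"
  have \<rho>c: "\<rho> \<in> carrier_mat 4 4" and K: "K \<in> carrier_mat 4 4"
    using \<rho> by (auto simp: density_op_def psd_def K_def)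
  have bK: "blk 2 K p q = Q p q" if "p \<in> qubits" "q \<in> qubits" for p q
    using pair_index_2_less[OF that(1)] pair_index_2_less[OF that(2)] that
    by (auto simp: K_def blk_def)
  have lin: "linear_superop 4 4 \<Lambda>" using \<Lambda>(1) by (simp add: cptp_map_def cp_map_def)
  have c: "\<Lambda> \<rho> \<in> carrier_mat 4 4" "\<Lambda> K \<in> carrier_mat 4 4"
    and add: "\<Lambda> (\<rho> + K) = \<Lambda> \<rho> + \<Lambda> K"
    using lin \<rho>c K by (auto simp: linear_superop_def)
  have \<psi>c: "\<psi> \<in> carrier_vec 4" using max_entangled_coeffs[OF \<psi>] by blast
  have "pos_form qubits (pt (blk 2 (\<rho> + K)))"
  proof -
    have "pt (blk 2 (\<rho> + K)) p q = pt (blk 2 \<rho>) p q + pt Q p q" if "p \<in> qubits" "q \<in> qubits" for p q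
      using that \<rho>c K bK[of "(fst p, snd q)" "(fst q, snd p)"] pair_index_2_less[of "(fst p, snd q)"] pair_index_2_less[of "(fst q, snd p)"]
      by (auto simp: pt_def blk_def)
    then show ?thesis using Q(2) by (subst pos_form_cong) auto
  qed
  then have "psd (2 * 2) (ptranspose 2 2 (\<rho> + K))" by (simp only: psd_ptranspose_iff)
  moreover have "\<rho> + K \<in> carrier_mat (2 * 2) (2 * 2)" using \<rho>c K by simp
  ultimately have "psd (2 * 2) (ptranspose 2 2 (\<Lambda> (\<rho> + K)))"
    using \<Lambda>(2) unfolding ppt_preserving_def by blast
  then have ppt: "pos_form qubits (pt (blk 2 (\<Lambda> (\<rho> + K))))" by (simp only: psd_ptranspose_iff)
  have "psd 4 K"
  proof -
    have "pos_form qubits (blk 2 K)" using Q(1) by (subst pos_form_cong[OF bK])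
    then have "psd (2 * 2) K" using K by (simp only: psd_iff_blk) simp
    then show ?thesis by simp
  qed
  \<comment> \<open>Plain positivity of the map is complete positivity with a one-dimensional
    ancilla.\<close>
  then have "psd 4 (id_tensor 1 4 4 \<Lambda> K)"
    using \<Lambda>(1) unfolding cptp_map_def cp_map_def by (metis mult_1)
  moreover have "id_tensor 1 4 4 \<Lambda> K = \<Lambda> K"
  proof -
    have "mat 4 4 (\<lambda>(r,s). K $$ (r,s)) = K" using K by (intro eq_matI) auto
    then show ?thesis using c(2) by (intro eq_matI) (auto simp: id_tensor_def)
  qed
  ultimately have "0 \<le> (\<Lambda> K *\<^sub>v \<psi>) \<bullet>c \<psi>" using \<psi>c by (simp add: psd_def)
  moreover have "(\<Lambda> (\<rho> + K) *\<^sub>v \<psi>) \<bullet>c \<psi> = (\<Lambda> \<rho> *\<^sub>v \<psi>) \<bullet>c \<psi> + (\<Lambda> K *\<^sub>v \<psi>) \<bullet>c \<psi>"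
    unfolding add using c \<psi>c by (simp add: add_mult_distrib_mat_vec[of _ 4 4] add_scalar_prod_distrib[of _ 4])
  moreover have "Re ((\<Lambda> (\<rho> + K) *\<^sub>v \<psi>) \<bullet>c \<psi>) \<le> Re (mat_trace (\<Lambda> (\<rho> + K))) / 2"
    using c by (intro max_entangled_ppt_bound ppt \<psi>) (simp add: add)
  moreover have "mat_trace (\<Lambda> (\<rho> + K)) = mat_trace (\<rho> + K)"
    using \<Lambda>(1) \<rho>c K by (simp add: cptp_map_def)
  moreover have "mat_trace (\<rho> + K) = mat_trace \<rho> + mat_trace K"
    using \<rho>c K by (simp add: mat_trace_def sum.distrib)
  moreover have "mat_trace K = (\<Sum>p\<in>qubits. Q p p)"
    unfolding mat_trace_blk[OF K] by (intro sum.cong refl bK)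
  moreover have "mat_trace \<rho> = 1" using \<rho> by (simp add: density_op_def)
  ultimately show ?thesis by (simp add: less_eq_complex_def)
qed

section \<open>Kraus families of product operators\<close>

definition kraus_map :: "nat \<Rightarrow> nat \<Rightarrow> nat \<Rightarrow> (nat \<Rightarrow> nat \<Rightarrow> nat \<Rightarrow> complex) \<Rightarrow> superop" where
  "kraus_map n m N K X = mat m m (\<lambda>(i,j). \<Sum>k<N. \<Sum>r<n. \<Sum>s<n. K k i r * X $$ (r,s) * cnj (K k j s))"

lemma pos_form_congruence:
  assumes "pos_form I W"
  shows "pos_form J (\<lambda>x y. \<Sum>u\<in>I. \<Sum>v\<in>I. C x u * W u v * cnj (C y v))"
  unfolding pos_form_def
proof
  fix f
  define g where "g u = (\<Sum>x\<in>J. cnj (C x u) * f x)" for u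
  have "sform J (\<lambda>x y. \<Sum>u\<in>I. \<Sum>v\<in>I. C x u * W u v * cnj (C y v)) f f
     = (\<Sum>x\<in>J. \<Sum>y\<in>J. \<Sum>u\<in>I. \<Sum>v\<in>I. cnj (f x) * C x u * W u v * cnj (C y v) * f y)"
    by (simp add: sform_def sum_distrib_left sum_distrib_right mult.assoc)
  also have "\<dots> = (\<Sum>x\<in>J. \<Sum>u\<in>I. \<Sum>y\<in>J. \<Sum>v\<in>I. cnj (f x) * C x u * W u v * cnj (C y v) * f y)"
    by (intro sum.cong refl sum.swap)
  also have "\<dots> = (\<Sum>x\<in>J. \<Sum>u\<in>I. \<Sum>v\<in>I. \<Sum>y\<in>J. cnj (f x) * C x u * W u v * cnj (C y v) * f y)"
    by (intro sum.cong refl sum.swap)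
  also have "\<dots> = (\<Sum>x\<in>J. \<Sum>u\<in>I. cnj (f x) * C x u * (\<Sum>v\<in>I. W u v * g v))"
    by (simp add: g_def sum_distrib_left mult.assoc)
  also have "\<dots> = (\<Sum>u\<in>I. \<Sum>x\<in>J. cnj (f x) * C x u * (\<Sum>v\<in>I. W u v * g v))"
    by (rule sum.swap)
  also have "\<dots> = (\<Sum>u\<in>I. cnj (g u) * (\<Sum>v\<in>I. W u v * g v))"
    by (simp add: g_def sum_distrib_right mult_ac)
  also have "\<dots> = sform I W g g" by (simp add: sform_def sum_distrib_left mult.assoc)
  also have "0 \<le> \<dots>" using assms by (simp add: pos_form_def)
  finally show "0 \<le> sform J (\<lambda>x y. \<Sum>u\<in>I. \<Sum>v\<in>I. C x u * W u v * cnj (C y v)) f f" .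
qed

lemma kraus_map_linear: "linear_superop n m (kraus_map n m N K)"
  unfolding linear_superop_def
proof (intro conjI ballI allI)
  fix X Y :: "complex mat" and c
  assume X: "X \<in> carrier_mat n n"
  show "kraus_map n m N K X \<in> carrier_mat m m" by (simp add: kraus_map_def)
  show "kraus_map n m N K (c \<cdot>\<^sub>m X) = c \<cdot>\<^sub>m kraus_map n m N K X"
    using X by (intro eq_matI) (auto simp: kraus_map_def sum_distrib_left mult_ac)
  assume Y: "Y \<in> carrier_mat n n"
  show "kraus_map n m N K (X + Y) = kraus_map n m N K X + kraus_map n m N K Y"
    using X Y by (intro eq_matI) (auto simp: kraus_map_def ring_distribs sum.distrib)
qed

lemma kraus_map_cp: "cp_map n m (kraus_map n m N K)"
  unfolding cp_map_def
proof (intro conjI allI impI)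
  fix k X assume "psd (k * n) X"
  then have pos: "pos_form ({..<k} \<times> {..<n}) (blk n X)" by (simp add: psd_iff_blk)
  \<comment> \<open>\<open>C t\<close> is the matrix of 1 (x) K t, so the lifted map is a sum of
    congruences.\<close>
  define C where "C t p u = (if fst u = fst p then K t (snd p) (snd u) else 0)" for t and p u :: "nat \<times> nat"
  have "pos_form ({..<k} \<times> {..<m}) (\<lambda>p q. \<Sum>t<N. \<Sum>u\<in>{..<k} \<times> {..<n}. \<Sum>v\<in>{..<k} \<times> {..<n}. C t p u * blk n X u v * cnj (C t q v))"
    by (rule pos_form_sum) (rule pos_form_congruence[OF pos])
  moreover have "(\<Sum>t<N. \<Sum>u\<in>{..<k} \<times> {..<n}. \<Sum>v\<in>{..<k} \<times> {..<n}. C t p u * blk n X u v * cnj (C t q v))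
     = blk m (id_tensor k n m (kraus_map n m N K) X) p q"
    if p: "p \<in> {..<k} \<times> {..<m}" and q: "q \<in> {..<k} \<times> {..<m}" for p q
  proof -
    have "(\<Sum>u\<in>{..<k} \<times> {..<n}. \<Sum>v\<in>{..<k} \<times> {..<n}. C t p u * blk n X u v * cnj (C t q v))
      = (\<Sum>r<n. \<Sum>s<n. K t (snd p) r * blk n X (fst p, r) (fst q, s) * cnj (K t (snd q) s))" for t
    proof -
      have v: "(\<Sum>v\<in>{..<k} \<times> {..<n}. c * blk n X u v * cnj (C t q v))
        = (\<Sum>s<n. c * blk n X u (fst q, s) * cnj (K t (snd q) s))" for u c
      proof -
        have "(\<Sum>v\<in>{..<k} \<times> {..<n}. c * blk n X u v * cnj (C t q v))
          = (\<Sum>a<k. if a = fst q then (\<Sum>s<n. c * blk n X u (fst q, s) * cnj (K t (snd q) s)) else 0)"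
          unfolding sum.cartesian_product' by (intro sum.cong refl) (auto simp: C_def)
        then show ?thesis using q by auto
      qed
      have "(\<Sum>u\<in>{..<k} \<times> {..<n}. \<Sum>s<n. C t p u * blk n X u (fst q, s) * cnj (K t (snd q) s))
        = (\<Sum>a<k. if a = fst p then (\<Sum>r<n. \<Sum>s<n. K t (snd p) r * blk n X (fst p, r) (fst q, s) * cnj (K t (snd q) s)) else 0)"
        unfolding sum.cartesian_product' by (intro sum.cong refl) (auto simp: C_def)
      then show ?thesis unfolding v using p by auto
    qed
    then show ?thesis
      using p q by (simp add: blk_id_tensor lift_map_def kraus_map_def mem_Times_iff)
  qed
  ultimately have "pos_form ({..<k} \<times> {..<m}) (blk m (id_tensor k n m (kraus_map n m N K) X))"
    by (subst (asm) pos_form_cong) auto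
  then show "psd (k * m) (id_tensor k n m (kraus_map n m N K) X)"
    by (simp add: psd_iff_blk) (simp add: id_tensor_def)
qed (rule kraus_map_linear)

lemma kraus_map_trace:
  "mat_trace (kraus_map n m N K X) = (\<Sum>r<n. \<Sum>s<n. X $$ (r,s) * (\<Sum>k<N. \<Sum>i<m. cnj (K k i s) * K k i r))"
proof -
  have "mat_trace (kraus_map n m N K X) = (\<Sum>i<m. \<Sum>k<N. \<Sum>r<n. \<Sum>s<n. K k i r * X $$ (r,s) * cnj (K k i s))"
    by (simp add: mat_trace_def kraus_map_def)
  also have "\<dots> = (\<Sum>k<N. \<Sum>i<m. \<Sum>r<n. \<Sum>s<n. K k i r * X $$ (r,s) * cnj (K k i s))"
    by (rule sum.swap)
  also have "\<dots> = (\<Sum>k<N. \<Sum>r<n. \<Sum>i<m. \<Sum>s<n. K k i r * X $$ (r,s) * cnj (K k i s))"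
    by (intro sum.cong refl sum.swap)
  also have "\<dots> = (\<Sum>r<n. \<Sum>k<N. \<Sum>i<m. \<Sum>s<n. K k i r * X $$ (r,s) * cnj (K k i s))"
    by (rule sum.swap)
  also have "\<dots> = (\<Sum>r<n. \<Sum>k<N. \<Sum>s<n. \<Sum>i<m. K k i r * X $$ (r,s) * cnj (K k i s))"
    by (intro sum.cong refl sum.swap)
  also have "\<dots> = (\<Sum>r<n. \<Sum>s<n. \<Sum>k<N. \<Sum>i<m. K k i r * X $$ (r,s) * cnj (K k i s))"
    by (intro sum.cong refl sum.swap)
  finally show ?thesis by (simp add: sum_distrib_left mult_ac)
qed

lemma trace_delta:
  assumes "X \<in> carrier_mat n n" "\<And>r s. r < n \<Longrightarrow> s < n \<Longrightarrow> c r s = (if r = s then 1 else 0)"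
  shows "(\<Sum>r<n. \<Sum>s<n. X $$ (r,s) * c r s) = mat_trace X"
proof -
  have "(\<Sum>r<n. \<Sum>s<n. X $$ (r,s) * c r s) = (\<Sum>r<n. \<Sum>s<n. if r = s then X $$ (r,r) else 0)"
    using assms(2) by (intro sum.cong refl) auto
  then show ?thesis using assms(1) by (simp add: mat_trace_def)
qed

text \<open>A separable map with Kraus operators S k (x) T k: the common ground between the protocol
  tree and an explicit dual state.\<close>

definition product_kraus :: "nat \<Rightarrow> (nat \<Rightarrow> nat \<Rightarrow> nat \<Rightarrow> complex) \<Rightarrow> (nat \<Rightarrow> nat \<Rightarrow> nat \<Rightarrow> complex) \<Rightarrow> superop" where
  "product_kraus N S T = kraus_map 4 4 N (\<lambda>k i r. S k (i div 2) (r div 2) * T k (i mod 2) (r mod 2))"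

lemma sum_4_qubits: "(\<Sum>i<4. f i) = (\<Sum>x\<in>qubits. f (fst x * 2 + snd x))"
  using sum.reindex_bij_betw[OF pair_index_bij[where k = 2 and n = 2], of f] by simp

lemma blk_product_kraus:
  assumes "p \<in> qubits" "q \<in> qubits"
  shows "blk 2 (product_kraus N S T X) p q = (\<Sum>k<N. \<Sum>x\<in>qubits. \<Sum>y\<in>qubits.
    S k (fst p) (fst x) * T k (snd p) (snd x) * blk 2 X x y * cnj (S k (fst q) (fst y) * T k (snd q) (snd y)))"
  using assms pair_index_2_less[OF assms(1)] pair_index_2_less[OF assms(2)]
  by (auto simp: blk_def product_kraus_def kraus_map_def sum_4_qubits mem_Times_iff intro!: sum.cong)

lemma div_mod_2_eq_iff: "i div 2 = j div 2 \<and> i mod 2 = j mod 2 \<longleftrightarrow> i = (j::nat)"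
  by (metis div_mult_mod_eq)

lemma product_kraus_cptp:
  assumes "\<And>x y. x \<in> qubits \<Longrightarrow> y \<in> qubits \<Longrightarrow>
    (\<Sum>k<N. (\<Sum>i<2. cnj (S k i (fst x)) * S k i (fst y)) * (\<Sum>j<2. cnj (T k j (snd x)) * T k j (snd y)))
    = (if x = y then 1 else 0)"
  shows "cptp_map 4 4 (product_kraus N S T)"
  unfolding cptp_map_def
proof (intro conjI ballI)
  show "cp_map 4 4 (product_kraus N S T)" unfolding product_kraus_def by (rule kraus_map_cp)
  fix X :: "complex mat" assume X: "X \<in> carrier_mat 4 4"
  show "mat_trace (product_kraus N S T X) = mat_trace X"
    unfolding product_kraus_def kraus_map_trace
  proof (rule trace_delta[OF X])
    fix r s :: nat assume rs: "r < 4" "s < 4"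
    then have q: "(r div 2, r mod 2) \<in> qubits" "(s div 2, s mod 2) \<in> qubits" by auto
    have "(\<Sum>k<N. \<Sum>i<4. cnj (S k (i div 2) (s div 2) * T k (i mod 2) (s mod 2)) * (S k (i div 2) (r div 2) * T k (i mod 2) (r mod 2)))
      = (\<Sum>k<N. (\<Sum>i<2. cnj (S k i (s div 2)) * S k i (r div 2)) * (\<Sum>j<2. cnj (T k j (s mod 2)) * T k j (r mod 2)))"
      unfolding sum_4_qubits by (simp add: sum_qubits sum_lessThan_2 algebra_simps)
    also have "\<dots> = (if r = s then 1 else 0)"
      using assms[OF q(2,1)] by (simp only: prod.inject fst_conv snd_conv div_mod_2_eq_iff) auto
    finally show "(\<Sum>k<N. \<Sum>i<4. cnj (S k (i div 2) (s div 2) * T k (i mod 2) (s mod 2)) * (S k (i div 2) (r div 2) * T k (i mod 2) (r mod 2)))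
      = (if r = s then 1 else 0)" .
  qed
qed

text \<open>The dual state is a sum of rank one operators on product vectors of AA' and BB'. Partial
  transposition conjugates the BB' factor of each vector, which again gives a sum of rank one
  operators.\<close>

lemma product_kraus_ppt_operation:
  assumes tp: "\<And>x y. x \<in> qubits \<Longrightarrow> y \<in> qubits \<Longrightarrow>
    (\<Sum>k<N. (\<Sum>i<2. cnj (S k i (fst x)) * S k i (fst y)) * (\<Sum>j<2. cnj (T k j (snd x)) * T k j (snd y)))
    = (if x = y then 1 else 0)"
  shows "ppt_operation (product_kraus N S T)"
proof -
  define \<sigma> where "\<sigma> k x = S k (x mod 2) (x div 2)" for k and x :: nat
  define \<theta> where "\<theta> k y = T k (y mod 2) (y div 2)" for k and y :: nat
  \<comment> \<open>\<open>\<sigma>\<close> and \<open>\<theta>\<close> are the Kraus operators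
    flattened over AA' and BB'. The conjugation comes from the transpose in the duality relation,
    and the two factors 1/2 cancel its 4.\<close>
  define R where "R = mat 16 16 (\<lambda>(u,v). \<Sum>k<N. (cnj (\<sigma> k (u div 4) * \<theta> k (u mod 4)) / 2) * cnj (cnj (\<sigma> k (v div 4) * \<theta> k (v mod 4)) / 2))"
  have Rc: "R \<in> carrier_mat 16 16" by (simp add: R_def)
  have \<sigma>: "\<sigma> k (2 * a + a') = S k a' a" and \<theta>: "\<theta> k (2 * a + a') = T k a' a" if "a' < 2" for k a a'
    using that by (simp_all add: \<sigma>_def \<theta>_def)
  have R: "R $$ (idx4 a a' b b', idx4 c c' d d') = (\<Sum>k<N. cnj (S k a' a * T k b' b) * (S k c' c * T k d' d)) / 4"
    if "a < 2" "a' < 2" "b < 2" "b' < 2" "c < 2" "c' < 2" "d < 2" "d' < 2" for a a' b b' c c' d d'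
  proof -
    have "idx4 a a' b b' < 16" "idx4 c c' d d' < 16" using that by (simp_all add: idx4_def)
    then show ?thesis using that
      by (simp add: R_def idx4_div_mod_4 \<sigma> \<theta> sum_divide_distrib)
  qed
  have "psd 16 R"
  proof -
    have "pos_form {..<16} (\<lambda>u v. \<Sum>k<N. (cnj (\<sigma> k (u div 4) * \<theta> k (u mod 4)) / 2) * cnj (cnj (\<sigma> k (v div 4) * \<theta> k (v mod 4)) / 2))"
      by (rule pos_form_sum) (rule pos_form_rank_one)
    then show ?thesis unfolding psd_iff_pos_form using Rc by (subst pos_form_cong) (auto simp: R_def)
  qed
  moreover have "psd 16 (ptranspose 4 4 R)"
  proof -
    have "pos_form {..<16} (\<lambda>u v. \<Sum>k<N. (cnj (\<sigma> k (u div 4)) * \<theta> k (u mod 4) / 2) * cnj (cnj (\<sigma> k (v div 4)) * \<theta> k (v mod 4) / 2))"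
      by (rule pos_form_sum) (rule pos_form_rank_one)
    moreover have "ptranspose 4 4 R $$ (u,v) = (\<Sum>k<N. (cnj (\<sigma> k (u div 4)) * \<theta> k (u mod 4) / 2) * cnj (cnj (\<sigma> k (v div 4)) * \<theta> k (v mod 4) / 2))"
      if uv: "u < 16" "v < 16" for u v
    proof -
      have "u div 4 * 4 + v mod 4 < 16" "v div 4 * 4 + u mod 4 < 16" using uv
        using pair_index_less[of "u div 4" 4 "v mod 4" 4] pair_index_less[of "v div 4" 4 "u mod 4" 4]
        by (simp_all add: less_mult_imp_div_less)
      then show ?thesis using uv by (simp add: ptranspose_def R_def mult_ac)
    qed
    ultimately show ?thesis unfolding psd_iff_pos_form
      by (subst pos_form_cong) (auto simp: ptranspose_def)
  qed
  moreover have "4 \<cdot>\<^sub>m ptrace_A'B' R = 1\<^sub>m 4"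
  proof (rule eq_matI)
    fix i j assume "i < dim_row (1\<^sub>m 4 :: complex mat)" "j < dim_col (1\<^sub>m 4 :: complex mat)"
    then have ij: "i < 4" "j < 4" by simp_all
    then have q: "(i div 2, i mod 2) \<in> qubits" "(j div 2, j mod 2) \<in> qubits" by auto
    have "(4 \<cdot>\<^sub>m ptrace_A'B' R) $$ (i,j) = (\<Sum>k<N. (\<Sum>a<2. cnj (S k a (i div 2)) * S k a (j div 2)) * (\<Sum>b<2. cnj (T k b (i mod 2)) * T k b (j mod 2)))"
      using ij q by (simp add: ptrace_A'B'_def R sum_lessThan_2 mem_Times_iff sum.distrib algebra_simps)
    also have "\<dots> = (if i = j then 1 else 0)"
      using tp[OF q] by (simp only: prod.inject fst_conv snd_conv div_mod_2_eq_iff)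
    finally show "(4 \<cdot>\<^sub>m ptrace_A'B' R) $$ (i,j) = 1\<^sub>m 4 $$ (i,j)" using ij by simp
  qed (simp_all add: ptrace_A'B'_def)
  moreover have "transpose_mat (product_kraus N S T X) = 4 \<cdot>\<^sub>m ptrace_AB (R * tensor_I_A'B' X)"
    if X: "X \<in> carrier_mat 4 4" for X
  proof (rule eq_matI)
    fix i j assume "i < dim_row (4 \<cdot>\<^sub>m ptrace_AB (R * tensor_I_A'B' X))" "j < dim_col (4 \<cdot>\<^sub>m ptrace_AB (R * tensor_I_A'B' X))"
    then have ij: "i < 4" "j < 4" by (simp_all add: ptrace_AB_def)
    define p q where "p = (i div 2, i mod 2)" and "q = (j div 2, j mod 2)"
    have pq: "p \<in> qubits" "q \<in> qubits" using ij by (auto simp: p_def q_def)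
    have e: "fst p * 2 + snd p = i" "fst q * 2 + snd q = j" by (simp_all add: p_def q_def)
    have "transpose_mat (product_kraus N S T X) $$ (i,j) = blk 2 (product_kraus N S T X) q p"
      using ij by (simp add: blk_def e) (simp add: product_kraus_def kraus_map_def)
    also have "\<dots> = (\<Sum>k<N. \<Sum>x\<in>qubits. \<Sum>y\<in>qubits.
      S k (fst q) (fst x) * T k (snd q) (snd x) * blk 2 X x y * cnj (S k (fst p) (fst y) * T k (snd p) (snd y)))"
      by (rule blk_product_kraus[OF pq(2,1)])
    also have "\<dots> = (\<Sum>x\<in>qubits. \<Sum>y\<in>qubits. \<Sum>k<N.
      S k (fst q) (fst x) * T k (snd q) (snd x) * blk 2 X x y * cnj (S k (fst p) (fst y) * T k (snd p) (snd y)))"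
      by (subst sum.swap, intro sum.cong refl, rule sum.swap)
    also have "\<dots> = (\<Sum>x\<in>qubits. \<Sum>y\<in>qubits. 4 * (R $$ (idx4p (y,p), idx4p (x,q)) * blk 2 X x y))"
      using pq by (intro sum.cong refl) (auto simp: idx4p_def R sum_distrib_left sum_distrib_right mult_ac)
    also have "\<dots> = (\<Sum>y\<in>qubits. \<Sum>x\<in>qubits. 4 * (R $$ (idx4p (y,p), idx4p (x,q)) * blk 2 X x y))"
      by (rule sum.swap)
    also have "\<dots> = 4 * blk 2 (ptrace_AB (R * tensor_I_A'B' X)) p q"
      by (simp only: ptrace_AB_tensor[OF Rc X pq] sum_distrib_left)
    also have "\<dots> = (4 \<cdot>\<^sub>m ptrace_AB (R * tensor_I_A'B' X)) $$ (i,j)"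
      using ij by (simp add: blk_def e) (simp add: ptrace_AB_def)
    finally show "transpose_mat (product_kraus N S T X) $$ (i,j) = (4 \<cdot>\<^sub>m ptrace_AB (R * tensor_I_A'B' X)) $$ (i,j)" .
  qed (simp_all add: product_kraus_def kraus_map_def ptrace_AB_def)
  ultimately have "dual_state (product_kraus N S T) R \<and> psd 16 (ptranspose 4 4 R)"
    unfolding dual_state_def by blast
  moreover have "cptp_map 4 4 (product_kraus N S T)" by (rule product_kraus_cptp) (rule tp)
  ultimately show ?thesis unfolding ppt_operation_def by blast
qed

section \<open>The optimal protocol\<close>

text \<open>The operator 1 - u^* u is the probability effect left over by the filter; its positivity
  allows it to be factored into failure operators.\<close>

lemma contraction2_defect:
  assumes "contraction2 u"
  shows "pos_form {..<2::nat} (\<lambda>r s. (if r = s then 1 else 0) - (\<Sum>i<2. cnj (u (i,r)) * u (i,s)))"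
  unfolding pos_form_def
proof
  fix f :: "nat \<Rightarrow> complex"
  have "sform {..<2} (\<lambda>r s. (if r = s then 1 else 0) - (\<Sum>i<2. cnj (u (i,r)) * u (i,s))) f f
    = f 0 * cnj (f 0) + f 1 * cnj (f 1)
      - ((u (0,0) * f 0 + u (0,1) * f 1) * cnj (u (0,0) * f 0 + u (0,1) * f 1)
       + (u (1,0) * f 0 + u (1,1) * f 1) * cnj (u (1,0) * f 0 + u (1,1) * f 1))"
    by (simp add: sform_def sum_lessThan_2 algebra_simps)
  also have "\<dots> = of_real ((cmod (f 0))\<^sup>2 + (cmod (f 1))\<^sup>2 - ((cmod (u (0,0) * f 0 + u (0,1) * f 1))\<^sup>2
       + (cmod (u (1,0) * f 0 + u (1,1) * f 1))\<^sup>2))"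
    unfolding of_real_diff of_real_add cmod_power2_mult_cnj ..
  also have "0 \<le> \<dots>" using assms by (simp add: contraction2_def less_eq_complex_def)
  finally show "0 \<le> sform {..<2} (\<lambda>r s. (if r = s then 1 else 0) - (\<Sum>i<2. cnj (u (i,r)) * u (i,s))) f f" .
qed

text \<open>Kraus operators of the protocol: Bob applies the filter \<open>B\<close>, which is \<open>u\<close> with its rows exchanged and one
  sign changed (a singlet rotation); on failure, with Kraus operators \<open>|0\<rangle>\<langle>c\<^sub>k|\<close>, both parties end up in \<open>|00\<rangle>\<close>.\<close>

definition filter_kraus :: "(nat \<times> nat \<Rightarrow> complex) \<Rightarrow> nat \<Rightarrow> nat \<Rightarrow> complex" where
  "filter_kraus u i r = (if i = 0 then - u (1,r) else u (0,r))"

definition reset_kraus :: "(nat \<Rightarrow> complex) \<Rightarrow> nat \<Rightarrow> nat \<Rightarrow> complex" where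
  "reset_kraus c i r = (if i = 0 then cnj (c r) else 0)"

definition basis_row :: "nat \<Rightarrow> nat \<Rightarrow> complex" where
  "basis_row j r = (if r = j then 1 else 0)"

text \<open>Outcome 0 is success. The defect of a 2 x 2 filter needs at most two rank one terms,
  hence the failure outcomes 1 and 2.\<close>

definition bob_kraus :: "(nat \<times> nat \<Rightarrow> complex) \<Rightarrow> (nat \<Rightarrow> nat \<Rightarrow> complex) \<Rightarrow> nat \<Rightarrow> nat \<Rightarrow> nat \<Rightarrow> complex" where
  "bob_kraus u c x = (if x = 0 then filter_kraus u else reset_kraus (c (if x = 1 then 0 else 1)))"

text \<open>Alice discards her qubit and prepares |0>: a basis measurement whose two branches end in
  the same state.\<close>

definition alice_reset :: superop where
  "alice_reset X = mat_sum (2 * 2) 2 (\<lambda>j. tensor_id 2 2 2 (kraus_map 2 2 1 (\<lambda>_. reset_kraus (basis_row j))) X)"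

definition filter_locc :: "(nat \<times> nat \<Rightarrow> complex) \<Rightarrow> (nat \<Rightarrow> nat \<Rightarrow> complex) \<Rightarrow> superop" where
  "filter_locc u c X = mat_sum (2 * 2) 3 (\<lambda>x. (if x = 0 then (\<lambda>X. X) else alice_reset)
     (id_tensor 2 2 2 (kraus_map 2 2 1 (\<lambda>_. bob_kraus u c x)) X))"

text \<open>Five Kraus operators: one for success, and one for each of Bob's two failure outcomes
  combined with each of Alice's two reset operators. Bob's outcome is 1 for k in {1, 2} and 2 for k
  in {3, 4}; Alice's reset starts from |0> for k in {1, 3}.\<close>

definition filter_op :: "(nat \<times> nat \<Rightarrow> complex) \<Rightarrow> (nat \<Rightarrow> nat \<Rightarrow> complex) \<Rightarrow> superop" where
  "filter_op u c = product_kraus 5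
     (\<lambda>k i r. if k = 0 then (if i = r then 1 else 0) else reset_kraus (basis_row (if k \<in> {1,3} then 0 else 1)) i r)
     (\<lambda>k. bob_kraus u c (if k = 0 then 0 else if k \<in> {1,2} then 1 else 2))"

lemma sum_lessThan_3: "(\<Sum>i<(3::nat). f i) = f 0 + f 1 + (f 2 :: 'a :: comm_monoid_add)"
proof -
  have "{..<3::nat} = {0,1,2}" by auto
  then show ?thesis by (simp add: add.assoc)
qed

lemma sum_lessThan_5: "(\<Sum>i<(5::nat). f i) = f 0 + f 1 + f 2 + f 3 + (f 4 :: 'a :: comm_monoid_add)"
proof -
  have "{..<5::nat} = {0,1,2,3,4}" by auto
  then show ?thesis by (simp add: add.assoc)
qed

lemma kraus_instrument:
  assumes "0 < m" "\<And>r s. r < n \<Longrightarrow> s < n \<Longrightarrow> (\<Sum>x<N. \<Sum>i<m. cnj (K x i s) * K x i r) = (if r = s then 1 else 0)"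
  shows "instrument n N (\<lambda>_. m) (\<lambda>x. kraus_map n m 1 (\<lambda>_. K x))"
  unfolding instrument_def
proof (intro conjI allI impI ballI)
  fix X :: "complex mat" assume X: "X \<in> carrier_mat n n"
  have one: "(\<Sum>k<(1::nat). f k) = f 0" for f :: "nat \<Rightarrow> complex" by (simp add: One_nat_def)
  have "(\<Sum>x<N. mat_trace (kraus_map n m 1 (\<lambda>_. K x) X))
    = (\<Sum>x<N. \<Sum>r<n. \<Sum>s<n. X $$ (r,s) * (\<Sum>i<m. cnj (K x i s) * K x i r))"
    by (simp only: kraus_map_trace one)
  also have "\<dots> = (\<Sum>r<n. \<Sum>x<N. \<Sum>s<n. X $$ (r,s) * (\<Sum>i<m. cnj (K x i s) * K x i r))"
    by (rule sum.swap)
  also have "\<dots> = (\<Sum>r<n. \<Sum>s<n. \<Sum>x<N. X $$ (r,s) * (\<Sum>i<m. cnj (K x i s) * K x i r))"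
    by (intro sum.cong refl sum.swap)
  also have "\<dots> = (\<Sum>r<n. \<Sum>s<n. X $$ (r,s) * (\<Sum>x<N. \<Sum>i<m. cnj (K x i s) * K x i r))"
    by (simp only: sum_distrib_left)
  also have "\<dots> = mat_trace X" by (rule trace_delta[OF X assms(2)])
  finally show "(\<Sum>x<N. mat_trace (kraus_map n m 1 (\<lambda>_. K x) X)) = mat_trace X" .
qed (use assms(1) kraus_map_cp in auto)

section \<open>The filter protocol: completeness, its two presentations, and its overlap with the
  Bell vector\<close>

context
  fixes u :: "nat \<times> nat \<Rightarrow> complex" and c :: "nat \<Rightarrow> nat \<Rightarrow> complex"
  assumes defect: "\<And>r s. r < 2 \<Longrightarrow> s < 2 \<Longrightarrow>
    (if r = s then 1 else 0) - (\<Sum>i<2. cnj (u (i,r)) * u (i,s)) = (\<Sum>k<2. c k r * cnj (c k s))"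
begin

text \<open>The row exchange and the sign in \<open>filter_kraus\<close> are a unitary on the
  output, so the filter has the same defect as \<open>u\<close>; the two reset operators supply
  exactly this defect.\<close>

lemma bob_kraus_complete:
  assumes "r < 2" "s < 2"
  shows "(\<Sum>x<3. \<Sum>i<2. cnj (bob_kraus u c x i r) * bob_kraus u c x i s) = (if r = s then 1 else 0)"
  using defect[OF assms]
  by (simp add: sum_lessThan_3 sum_lessThan_2 bob_kraus_def filter_kraus_def reset_kraus_def algebra_simps)

text \<open>On Alice's side the two reset operators add up to the identity, so the five products
  collapse to Bob's three outcomes.\<close>

lemma filter_op_complete:
  assumes "x \<in> qubits" "y \<in> qubits"
  defines "S \<equiv> (\<lambda>(k::nat) i r. if k = 0 then (if i = r then 1 else 0) else reset_kraus (basis_row (if k \<in> {1,3} then 0 else 1)) i r)"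
  defines "T \<equiv> (\<lambda>k::nat. bob_kraus u c (if k = 0 then 0 else if k \<in> {1,2} then 1 else 2))"
  shows "(\<Sum>k<5. (\<Sum>i<2. cnj (S k i (fst x)) * S k i (fst y)) * (\<Sum>j<2. cnj (T k j (snd x)) * T k j (snd y)))
    = (if x = y then 1 else 0)"
proof -
  let ?t = "\<lambda>b. \<Sum>j<2. cnj (bob_kraus u c b j (snd x)) * bob_kraus u c b j (snd y)"
  have fs: "fst x = 0 \<or> fst x = 1" "fst y = 0 \<or> fst y = 1" using assms(1,2) by (auto simp: less_2_iff)
  have "(\<Sum>k<5. (\<Sum>i<2. cnj (S k i (fst x)) * S k i (fst y)) * (\<Sum>j<2. cnj (T k j (snd x)) * T k j (snd y)))
    = (if fst x = fst y then (\<Sum>b<3. ?t b) else 0)"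
  proof -
    have S0: "(\<Sum>i<2. cnj (S 0 i (fst x)) * S 0 i (fst y)) = (if fst x = fst y then 1 else 0)"
      using fs by (auto simp: S_def sum_lessThan_2)
    have S1: "(\<Sum>i<2. cnj (S k i (fst x)) * S k i (fst y)) = (if fst x = 0 \<and> fst y = 0 then 1 else 0)" if "k \<in> {1,3}" for k
      using fs that by (auto simp: S_def sum_lessThan_2 reset_kraus_def basis_row_def)
    have S2: "(\<Sum>i<2. cnj (S k i (fst x)) * S k i (fst y)) = (if fst x = 1 \<and> fst y = 1 then 1 else 0)" if "k \<in> {2,4}" for k
      using fs that by (auto simp: S_def sum_lessThan_2 reset_kraus_def basis_row_def)
    have T: "T 0 = bob_kraus u c 0" "T 1 = bob_kraus u c 1" "T 2 = bob_kraus u c 1" "T 3 = bob_kraus u c 2" "T 4 = bob_kraus u c 2"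
      by (simp_all add: T_def)
    show ?thesis
      unfolding sum_lessThan_5 T sum_lessThan_3[of ?t] using fs by (auto simp: S0 S1 S2)
  qed
  also have "(\<Sum>b<3. ?t b) = (if snd x = snd y then 1 else 0)"
    using assms(1,2) by (intro bob_kraus_complete) auto
  finally show ?thesis by (auto simp: prod_eq_iff)
qed

lemma filter_op_ppt: "ppt_operation (filter_op u c)"
  unfolding filter_op_def by (rule product_kraus_ppt_operation) (rule filter_op_complete)

lemma filter_op_carrier: "filter_op u c X \<in> carrier_mat 4 4"
  unfolding filter_op_def product_kraus_def kraus_map_def by (rule mat_carrier)

lemma filter_locc_carrier: "filter_locc u c X \<in> carrier_mat 4 4"
  unfolding filter_locc_def mat_sum_def by simp

lemma blk_filter_op:
  assumes "p \<in> qubits" "q \<in> qubits"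
  shows "blk 2 (filter_op u c X) p q
    = (\<Sum>r<2. \<Sum>s<2. bob_kraus u c 0 (snd p) r * blk 2 X (fst p, r) (fst q, s) * cnj (bob_kraus u c 0 (snd q) s))
    + (if fst p = 0 \<and> fst q = 0 then \<Sum>j<2. \<Sum>r<2. \<Sum>s<2.
        (bob_kraus u c 1 (snd p) r * blk 2 X (j,r) (j,s) * cnj (bob_kraus u c 1 (snd q) s)
         + bob_kraus u c 2 (snd p) r * blk 2 X (j,r) (j,s) * cnj (bob_kraus u c 2 (snd q) s)) else 0)"
proof -
  have fs: "fst p = 0 \<or> fst p = 1" "fst q = 0 \<or> fst q = 1" using assms by (auto simp: less_2_iff)
  show ?thesis
    unfolding filter_op_def blk_product_kraus[OF assms] using fs
    by (elim disjE) (simp_all add: sum_lessThan_5 sum_qubits sum_lessThan_2 reset_kraus_def basis_row_def)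
qed

lemma filter_op_eq_locc:
  assumes X: "X \<in> carrier_mat 4 4"
  shows "filter_op u c X = filter_locc u c X"
proof -
  have "blk 2 (filter_op u c X) p q = blk 2 (filter_locc u c X) p q" if p: "p \<in> qubits" and q: "q \<in> qubits" for p q
  proof -
    have idt: "blk 2 (id_tensor 2 2 2 (kraus_map 2 2 1 (\<lambda>_. K)) Y) p q
      = (\<Sum>r<2. \<Sum>s<2. K (snd p) r * blk 2 Y (fst p, r) (fst q, s) * cnj (K (snd q) s))"
      if "p \<in> qubits" "q \<in> qubits" for K Y p q
      using that by (simp add: blk_id_tensor lift_map_def kraus_map_def mem_Times_iff)
    have tid: "blk 2 (tensor_id 2 2 2 (kraus_map 2 2 1 (\<lambda>_. K)) Y) p q
      = (\<Sum>r<2. \<Sum>s<2. K (fst p) r * blk 2 Y (r, snd p) (s, snd q) * cnj (K (fst q) s))"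
      if "p \<in> qubits" "q \<in> qubits" for K Y p q
      using that by (simp add: blk_tensor_id lift_map_def kraus_map_def mem_Times_iff)
    have ms: "blk 2 (mat_sum (2 * 2) N F) p q = (\<Sum>x<N. blk 2 (F x) p q)" if "p \<in> qubits" "q \<in> qubits" for N F p q
      unfolding mat_sum_def using that by (subst blk_mat) (auto simp: blk_def)
    have ar: "blk 2 (alice_reset Y) p q = (if fst p = 0 \<and> fst q = 0 then (\<Sum>r<2. blk 2 Y (r, snd p) (r, snd q)) else 0)" for Y
      using p q unfolding alice_reset_def ms[OF p q] by (simp add: tid reset_kraus_def basis_row_def sum_lessThan_2)
    have fs: "fst p = 0 \<or> fst p = 1" "fst q = 0 \<or> fst q = 1" "fst p < 2" "fst q < 2" "snd p < 2" "snd q < 2"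
      using p q by (auto simp: less_2_iff)
    have "blk 2 (filter_locc u c X) p q = blk 2 (id_tensor 2 2 2 (kraus_map 2 2 1 (\<lambda>_. bob_kraus u c 0)) X) p q
       + blk 2 (alice_reset (id_tensor 2 2 2 (kraus_map 2 2 1 (\<lambda>_. bob_kraus u c 1)) X)) p q
       + blk 2 (alice_reset (id_tensor 2 2 2 (kraus_map 2 2 1 (\<lambda>_. bob_kraus u c 2)) X)) p q"
      unfolding filter_locc_def ms[OF p q] sum_lessThan_3 by simp
    also have "\<dots> = blk 2 (filter_op u c X) p q"
      unfolding ar blk_filter_op[OF p q] using p q
      by (simp add: idt fs sum.distrib)
    finally show ?thesis by simp
  qed
  note * = this
  show ?thesis
  proof (rule eq_matI)
    fix i j assume "i < dim_row (filter_locc u c X)" "j < dim_col (filter_locc u c X)"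
    then have "i < 4" "j < 4" by (simp_all only: carrier_matD[OF filter_locc_carrier])
    then have "(i div 2, i mod 2) \<in> qubits" "(j div 2, j mod 2) \<in> qubits" by auto
    from *[OF this] show "filter_op u c X $$ (i,j) = filter_locc u c X $$ (i,j)" by (simp add: blk_def)
  qed (simp_all only: carrier_matD[OF filter_locc_carrier] carrier_matD[OF filter_op_carrier])
qed

lemma filter_locc_locc: "locc 2 2 2 2 (filter_locc u c)"
proof -
  have ar: "locc 2 2 2 2 alice_reset"
  proof -
    have "instrument 2 2 (\<lambda>_. 2) (\<lambda>j. kraus_map 2 2 1 (\<lambda>_. reset_kraus (basis_row j)))"
      by (rule kraus_instrument) (auto simp: sum_lessThan_2 reset_kraus_def basis_row_def less_2_iff)
    from locc_Alice[OF this, of 2 2 2 "\<lambda>_ X. X"] show ?thesis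
      by (simp add: alice_reset_def[abs_def] locc_done)
  qed
  have "instrument 2 3 (\<lambda>_. 2) (\<lambda>x. kraus_map 2 2 1 (\<lambda>_. bob_kraus u c x))"
    by (rule kraus_instrument) (auto simp: bob_kraus_complete)
  from locc_Bob[OF this, of 2 2 2 "\<lambda>x. if x = 0 then (\<lambda>X. X) else alice_reset"] ar
  show ?thesis by (simp add: filter_locc_def[abs_def] locc_done)
qed

text \<open>The singlet rotation turns twice the Bell projection into 1 - swap, and the swap is
  itself a partial transpose. Success thus contributes tr X (1 (x) u^* u) - <u|X^G|u>. Failure
  contributes tr X (1 (x) (1 - u^* u)), because |00> has overlap 1/2 with the Bell vector. The terms
  with u^* u cancel.\<close>

lemma filter_op_bell:
  assumes X: "X \<in> carrier_mat 4 4"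
  shows "((filter_op u c X *\<^sub>v bell_vec) \<bullet>c bell_vec) * 2 = mat_trace X - sform qubits (pt (blk 2 X)) u u"
proof -
  note F = filter_op_carrier[of X]
  have b: "bell_vec \<in> carrier_vec 4" by (simp add: bell_vec_def)
  have "(filter_op u c X *\<^sub>v bell_vec) \<bullet>c bell_vec
    = sform qubits (blk 2 (filter_op u c X)) (\<lambda>p. of_real (1 / sqrt 2) * (if fst p = snd p then 1 else 0))
       (\<lambda>p. of_real (1 / sqrt 2) * (if fst p = snd p then 1 else 0))"
    unfolding mult_vec_cscalar_blk[OF F b]
    by (rule sform_cong) (auto simp: bell_vec_def less_2_iff)
  also have "\<dots> = of_real (1 / sqrt 2 * (1 / sqrt 2)) *
     sform qubits (blk 2 (filter_op u c X)) (\<lambda>p. if fst p = snd p then 1 else 0) (\<lambda>p. if fst p = snd p then 1 else 0)"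
    by (simp only: sform_scale_left sform_scale_right of_real_mult complex_cnj_complex_of_real mult.assoc)
  finally have "((filter_op u c X *\<^sub>v bell_vec) \<bullet>c bell_vec) * 2
    = sform qubits (blk 2 (filter_op u c X)) (\<lambda>p. if fst p = snd p then 1 else 0) (\<lambda>p. if fst p = snd p then 1 else 0)"
    by simp
  also have "\<dots> = (\<Sum>i<2. \<Sum>k<2. blk 2 (filter_op u c X) (i,i) (k,k))"
    by (simp add: sform_def sum_qubits sum_lessThan_2)
  also have "\<dots> = (\<Sum>i<2. \<Sum>k<2. \<Sum>r<2. \<Sum>s<2. filter_kraus u i r * blk 2 X (i,r) (k,s) * cnj (filter_kraus u k s))
     + (\<Sum>j<2. \<Sum>r<2. \<Sum>s<2. (\<Sum>k<2. c k s * cnj (c k r)) * blk 2 X (j,r) (j,s))" (is "_ = ?A + ?B")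
  proof -
    have bob: "bob_kraus u c 0 = filter_kraus u" "bob_kraus u c 1 0 r = cnj (c 0 r)" "bob_kraus u c 2 0 r = cnj (c 1 r)" for r
      by (simp_all add: bob_kraus_def reset_kraus_def)
    \<comment> \<open>Failure outputs |00>, so it enters only at i = k = 0, with total weight
      \<open>?B\<close>.\<close>
    have "blk 2 (filter_op u c X) (i,i) (k,k) = (\<Sum>r<2. \<Sum>s<2. filter_kraus u i r * blk 2 X (i,r) (k,s) * cnj (filter_kraus u k s))
       + (if i = 0 \<and> k = 0 then ?B else 0)" if "i < 2" "k < 2" for i k
    proof -
      have "(\<Sum>j<2. \<Sum>r<2. \<Sum>s<2. cnj (c 0 r) * blk 2 X (j,r) (j,s) * cnj (cnj (c 0 s)) + cnj (c 1 r) * blk 2 X (j,r) (j,s) * cnj (cnj (c 1 s))) = ?B"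
        by (intro sum.cong refl) (simp add: sum_lessThan_2 algebra_simps)
      then show ?thesis using that by (subst blk_filter_op) (auto simp: bob)
    qed
    then have "(\<Sum>i<2. \<Sum>k<2. blk 2 (filter_op u c X) (i,i) (k,k)) = (\<Sum>i<2. \<Sum>k<2.
        (\<Sum>r<2. \<Sum>s<2. filter_kraus u i r * blk 2 X (i,r) (k,s) * cnj (filter_kraus u k s)) + (if i = 0 \<and> k = 0 then ?B else 0))"
      by (intro sum.cong refl) simp
    also have "\<dots> = ?A + (\<Sum>i<(2::nat). \<Sum>k<(2::nat). if i = 0 \<and> k = 0 then ?B else 0)" by (simp only: sum.distrib)
    also have "(\<Sum>i<(2::nat). \<Sum>k<(2::nat). if i = 0 \<and> k = 0 then ?B else 0) = ?B"
    proof -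
      have "(\<Sum>i<(2::nat). \<Sum>k<(2::nat). if i = 0 \<and> k = 0 then z else 0) = z" for z :: complex
        by (simp add: sum_lessThan_2)
      then show ?thesis .
    qed
    finally show ?thesis .
  qed
  also have "?B = (\<Sum>j<2. \<Sum>r<2. \<Sum>s<2. ((if s = r then 1 else 0) - (\<Sum>i<2. cnj (u (i,s)) * u (i,r))) * blk 2 X (j,r) (j,s))"
    by (intro sum.cong refl) (simp add: defect)
  also have "?A + \<dots> = (\<Sum>p\<in>qubits. blk 2 X p p) - sform qubits (pt (blk 2 X)) u u"
    by (simp add: sform_def pt_def sum_qubits sum_lessThan_2 filter_kraus_def algebra_simps)
  finally show ?thesis by (simp only: mat_trace_blk[OF X])
qed

end

theorem mainTheorem4:
  fixes \<rho> :: "complex mat"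
  assumes "density_op 4 \<rho>"
  shows "(\<exists>\<Lambda>\<^sub>0. is_arg_max (\<lambda>\<Lambda>. fidelity (\<Lambda> \<rho>)) ppt_operation \<Lambda>\<^sub>0 \<and>
              is_arg_max (\<lambda>\<Lambda>. fidelity (\<Lambda> \<rho>)) locc_operation \<Lambda>\<^sub>0) \<and>
         (SUP \<Lambda> \<in> Collect ppt_operation. fidelity (\<Lambda> \<rho>)) =
         (SUP \<Lambda> \<in> Collect locc_operation. fidelity (\<Lambda> \<rho>))"
proof -
  have "psd (2 * 2) \<rho>" and \<rho>: "\<rho> \<in> carrier_mat 4 4" and tr: "mat_trace \<rho> = 1"
    using assms by (simp_all add: density_op_def psd_def)
  then have "pos_form qubits (blk 2 \<rho>)" by (simp only: psd_iff_blk)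
  then obtain u Q where u: "contraction2 u" and Q: "pos_form qubits Q"
      "pos_form qubits (\<lambda>p q. pt (blk 2 \<rho>) p q + pt Q p q)"
    and trQ: "(\<Sum>p\<in>qubits. Q p p) = - sform qubits (pt (blk 2 \<rho>)) u u"
    by (rule filter_witness_duality)
  obtain c where c: "\<forall>r\<in>{..<2}. \<forall>s\<in>{..<2}.
      (if r = s then 1 else 0) - (\<Sum>i<2. cnj (u (i,r)) * u (i,s)) = (\<Sum>k\<in>{..<2::nat}. c k r * cnj (c k s))"
    using pos_form_decomp[OF _ contraction2_defect[OF u]] by blast
  then have defect: "(if r = s then 1 else 0) - (\<Sum>i<2. cnj (u (i,r)) * u (i,s)) = (\<Sum>k<2. c k r * cnj (c k s))"
    if "r < 2" "s < 2" for r s using that by blast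
  \<comment> \<open>The common value. By \<open>trQ\<close> it is also 1/2 - <u|rho^G|u> / 2, the
    overlap that the protocol reaches.\<close>
  define V where "V = (1 + Re (\<Sum>p\<in>qubits. Q p p)) / 2"
  define \<Lambda>0 where "\<Lambda>0 = filter_op u c"
  have ppt_bound: "Re ((\<Lambda> \<rho> *\<^sub>v \<psi>) \<bullet>c \<psi>) \<le> V" if "ppt_operation \<Lambda>" "\<psi> \<in> max_entangled" for \<Lambda> \<psi>
    unfolding V_def using that(1)
    by (intro fidelity_candidates_le assms Q that(2) ppt_operation_ppt_preserving) (simp_all add: ppt_operation_def)
  have locc_bound: "Re ((\<Lambda> \<rho> *\<^sub>v \<psi>) \<bullet>c \<psi>) \<le> V" if \<Lambda>: "locc_operation \<Lambda>" and \<psi>: "\<psi> \<in> max_entangled" for \<Lambda> \<psi>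
  proof -
    obtain \<Lambda>' where \<Lambda>': "locc 2 2 2 2 \<Lambda>'" "\<forall>X \<in> carrier_mat 4 4. \<Lambda> X = \<Lambda>' X" and cptp: "cptp_map 4 4 \<Lambda>"
      using \<Lambda> by (auto simp: locc_operation_def)
    \<comment> \<open>\<open>\<Lambda>\<close> agrees with the protocol only on 4 x 4 matrices, and
      those are all that \<open>ppt_preserving\<close> speaks about.\<close>
    have "ppt_preserving 2 2 2 2 \<Lambda>"
      using locc_ppt_preserving[OF \<Lambda>'(1)] \<Lambda>'(2) by (simp add: ppt_preserving_def)
    then show ?thesis unfolding V_def by (intro fidelity_candidates_le assms Q \<psi> cptp)
  qed
  have le: "fidelity (\<Lambda> \<rho>) \<le> V" if "ppt_operation \<Lambda> \<or> locc_operation \<Lambda>" for \<Lambda>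
    unfolding fidelity_def using that bell_vec_max_entangled ppt_bound locc_bound
    by (intro cSUP_least) auto
  have ppt0: "ppt_operation \<Lambda>0" unfolding \<Lambda>0_def by (rule filter_op_ppt) (rule defect)
  have locc0: "locc_operation \<Lambda>0"
    unfolding locc_operation_def
  proof (intro conjI exI ballI)
    show "cptp_map 4 4 \<Lambda>0" using ppt0 by (simp add: ppt_operation_def)
    show "locc 2 2 2 2 (filter_locc u c)" by (rule filter_locc_locc) (rule defect)
    show "\<Lambda>0 X = filter_locc u c X" if "X \<in> carrier_mat 4 4" for X
      unfolding \<Lambda>0_def by (rule filter_op_eq_locc[OF defect that])
  qed
  have "V = Re ((\<Lambda>0 \<rho> *\<^sub>v bell_vec) \<bullet>c bell_vec)"
    using arg_cong[OF filter_op_bell[OF defect \<rho>], of Re] by (simp add: V_def \<Lambda>0_def tr trQ)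
  \<comment> \<open>The upper bound for PPT-operations also supplies the boundedness under which the
    supremum dominates its candidates.\<close>
  also have "\<dots> \<le> fidelity (\<Lambda>0 \<rho>)"
    unfolding fidelity_def using ppt_bound[OF ppt0] by (intro cSUP_upper bell_vec_max_entangled bdd_aboveI2)
  finally have eq: "fidelity (\<Lambda>0 \<rho>) = V" using le ppt0 by (intro antisym) auto
  have "(SUP \<Lambda> \<in> Collect ppt_operation. fidelity (\<Lambda> \<rho>)) = V"
    by (rule cSup_eq_maximum) (use eq ppt0 le in auto)
  moreover have "(SUP \<Lambda> \<in> Collect locc_operation. fidelity (\<Lambda> \<rho>)) = V"
    by (rule cSup_eq_maximum) (use eq locc0 le in auto)
  moreover have "is_arg_max (\<lambda>\<Lambda>. fidelity (\<Lambda> \<rho>)) ppt_operation \<Lambda>0"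
    unfolding is_arg_max_def eq using ppt0 le by (auto simp: not_less)
  moreover have "is_arg_max (\<lambda>\<Lambda>. fidelity (\<Lambda> \<rho>)) locc_operation \<Lambda>0"
    unfolding is_arg_max_def eq using locc0 le by (auto simp: not_less)
  ultimately show ?thesis by auto
qed

end
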